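(* Let $X$ be a Banach space, let $g:[0,1]\to X$ be a function, and let $G:[0,1]\to ck(X)$ be the multifunction determined by $g$, i.e. $G(t)=\mathrm{conv}\{0,g(t)\}$ for every $t\in[0,1]$. Then $G$ is McShane integrable if and only if $g$ is McShane integrable; and $G$ is Birkhoff integrable if and only if $g$ is Birkhoff integrable.
   Context: $[0,1]$ carries Lebesgue measure $\lambda$, with $\Sigma$ the Lebesgue measurable sets; $|I|$ is the length of an interval $I$. $ck(X)$ is the family of all nonempty convex compact subsets of $X$, with the Hausdorff metric $d_H$ and Minkowski addition. A partition of $[0,1]$ is a finite collection of pairs $\{(I_1,t_1),\dots,(I_p,t_p)\}$ where $I_1,\dots,I_p$ are nonoverlapping closed subintervals of $[0,1]$ with union $[0,1]$, and $t_i\in[0,1]$ (not necessarily $t_i\in I_i$). A gauge is a function $\delta:[0,1]\to(0,\infty)$; a partition is $\delta$-fine if $I_i\subset(t_i-\delta(t_i),t_i+\delta(t_i))$ for all $i$. A multifunction $G:[0,1]\to ck(X)$ is McShane integrable if there exists $\Phi\in ck(X)$ such that for every $\varepsilon>0$ there is a gauge $\delta$ with $d_H(\Phi,\sum_{i=1}^p G(t_i)|I_i|)<\varepsilon$ for each $\delta$-fine partition $\{(I_i,t_i)\}_{i=1}^p$ of $[0,1]$. $G$ is Birkhoff integrable if there exists $\Phi\in ck(X)$ such that for every $\varepsilon>0$ there is a countable partition $P_0$ of $[0,1]$ into sets of $\Sigma$ such that for every countable partition $(A_n)_n$ of $[0,1]$ into sets of $\Sigma$ finer than $P_0$ and any choice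 $t_n\in A_n$, the series $\sum_n \lambda(A_n)G(t_n)$ is unconditionally convergent in the Hausdorff metric and $d_H(\Phi,\sum_n G(t_n)\lambda(A_n))<\varepsilon$. (Equivalently, Birkhoff integrability is the McShane integrability definition in which only measurable gauges are allowed.) McShane and Birkhoff integrability of a function $g:[0,1]\to X$ are defined in the same way, with $\Phi\in X$ and $d_H$ replaced by the norm distance. *)

theory Defs
  imports "HOL-Analysis.Analysis"
begin

text \<open>Sums of sets below are Minkowski sums: \<^theory>\<open>HOL-Library.Set_Algebras\<close>
  makes \<open>'a set\<close> a commutative monoid under elementwise addition, with zero \<open>{0}\<close>.\<close>

definition ck :: "'a::real_normed_vector set set" where
  "ck = {C. C \<noteq> {} \<and> convex C \<and> compact C}"

text \<open>The suprema are of bounded nonempty sets of reals only for nonempty bounded arguments;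
  the distance is used only on \<open>ck\<close>.\<close>

definition hausdorff_dist :: "'a::metric_space set \<Rightarrow> 'a set \<Rightarrow> real" where
  "hausdorff_dist A B = max (SUP a\<in>A. infdist a B) (SUP b\<in>B. infdist b A)"

subsection \<open>McShane integrability\<close>

text \<open>This is \<open>tagged_division_of\<close> for \<open>[0,1]\<close>, without the requirement that a tag lie in its
  interval. Pairs are \<open>(tag, interval)\<close>, the order used by \<open>fine\<close>. As in the library,
  one-point intervals are allowed; they contribute zero to every Riemann sum.\<close>

definition free_tagged_partition :: "(real \<times> real set) set \<Rightarrow> bool" where
  "free_tagged_partition p \<longleftrightarrow>
     finite p \<and>
     (\<forall>(t, I)\<in>p. t \<in> {0..1} \<and> I \<subseteq> {0..1} \<and> (\<exists>a b. a \<le> b \<and> I = {a..b})) \<and>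
     (\<forall>(t, I)\<in>p. \<forall>(t', I')\<in>p. (t, I) \<noteq> (t', I') \<longrightarrow> interior I \<inter> interior I' = {}) \<and>
     (\<Union>(t, I)\<in>p. I) = {0..1}"

definition McShane_integrable :: "(real \<Rightarrow> 'a::real_normed_vector) \<Rightarrow> bool" where
  "McShane_integrable g \<longleftrightarrow>
     (\<exists>\<Phi>. \<forall>\<epsilon>>0. \<exists>\<delta> :: real \<Rightarrow> real. (\<forall>t\<in>{0..1}. \<delta> t > 0) \<and>
        (\<forall>p. free_tagged_partition p \<and> (\<lambda>t. {t - \<delta> t<..<t + \<delta> t}) fine p \<longrightarrow>
           norm (\<Phi> - (\<Sum>(t, I)\<in>p. measure lborel I *\<^sub>R g t)) < \<epsilon>))"

definition McShane_integrable_multi :: "(real \<Rightarrow> 'a::real_normed_vector set) \<Rightarrow> bool" where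
  "McShane_integrable_multi G \<longleftrightarrow>
     (\<exists>\<Phi>\<in>ck. \<forall>\<epsilon>>0. \<exists>\<delta> :: real \<Rightarrow> real. (\<forall>t\<in>{0..1}. \<delta> t > 0) \<and>
        (\<forall>p. free_tagged_partition p \<and> (\<lambda>t. {t - \<delta> t<..<t + \<delta> t}) fine p \<longrightarrow>
           hausdorff_dist \<Phi> (\<Sum>(t, I)\<in>p. (\<lambda>x. measure lborel I *\<^sub>R x) ` G t) < \<epsilon>))"

subsection \<open>Birkhoff integrability\<close>

text \<open>A countable partition is a countable set of cells, so finite partitions are included and
  cells are nonempty (\<open>partition_on\<close>), and a choice of points is a function on the cells.\<close>

definition countable_measurable_partition :: "real set set \<Rightarrow> bool" where
  "countable_measurable_partition P \<longleftrightarrow>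
     countable P \<and> partition_on {0..1} P \<and> P \<subseteq> sets lebesgue"

text \<open>Unconditional convergence in the Hausdorff metric: \<open>has_sum\<close>, that is, convergence along
  the finite subsets of the index set, with \<open>hausdorff_dist\<close> in place of the
  topology of a type.\<close>

definition hausdorff_has_sum ::
    "('i \<Rightarrow> 'a::real_normed_vector set) \<Rightarrow> 'a set \<Rightarrow> 'i set \<Rightarrow> bool" where
  "hausdorff_has_sum F S A \<longleftrightarrow>
     S \<in> ck \<and> ((\<lambda>E. hausdorff_dist S (\<Sum>i\<in>E. F i)) \<longlongrightarrow> 0) (finite_subsets_at_top A)"

definition Birkhoff_integrable :: "(real \<Rightarrow> 'a::real_normed_vector) \<Rightarrow> bool" where
  "Birkhoff_integrable g \<longleftrightarrow>
     (\<exists>\<Phi>. \<forall>\<epsilon>>0. \<exists>P\<^sub>0. countable_measurable_partition P\<^sub>0 \<and>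
        (\<forall>P t. countable_measurable_partition P \<and> refines {0..1} P P\<^sub>0 \<and> (\<forall>A\<in>P. t A \<in> A) \<longrightarrow>
           (\<exists>s. ((\<lambda>A. measure lebesgue A *\<^sub>R g (t A)) has_sum s) P \<and> norm (\<Phi> - s) < \<epsilon>)))"

definition Birkhoff_integrable_multi :: "(real \<Rightarrow> 'a::real_normed_vector set) \<Rightarrow> bool" where
  "Birkhoff_integrable_multi G \<longleftrightarrow>
     (\<exists>\<Phi>\<in>ck. \<forall>\<epsilon>>0. \<exists>P\<^sub>0. countable_measurable_partition P\<^sub>0 \<and>
        (\<forall>P t. countable_measurable_partition P \<and> refines {0..1} P P\<^sub>0 \<and> (\<forall>A\<in>P. t A \<in> A) \<longrightarrow>
           (\<exists>S. hausdorff_has_sum (\<lambda>A. (\<lambda>x. measure lebesgue A *\<^sub>R x) ` G (t A)) S P \<and>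
                hausdorff_dist \<Phi> S < \<epsilon>)))"

end

theory Submission
  imports Defs
begin

text \<open>A Minkowski Riemann sum of \<open>G\<close> is a zonotope, i.e. a sum of segments \<open>[0, v i]\<close>. It is
  centrally symmetric: reflecting it in half of the corresponding Riemann sum \<open>\<Sum>i. v i\<close> of \<open>g\<close>
  maps it to itself. The centre of a symmetric bounded set depends in a Lipschitz way on the set,
  so convergence of the zonotopes implies convergence of their centres, the sums of \<open>g\<close>.

  Conversely, the Hausdorff distance of two zonotopes over the same index set is at most the
  largest norm of a partial sum of \<open>u i - v i\<close>. After passing to a common refinement such a
  partial sum is the difference of two Riemann sums of \<open>g\<close>, because tags may be exchanged on any
  set of cells. For Birkhoff sums, whose tags have to lie in their cells, the values on the finer
  cells are first collected into convex combinations of values on the coarser ones. Completeness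
  of \<open>ck\<close> then yields the integral of \<open>G\<close>.\<close>

subsection \<open>Completeness of the Hausdorff metric\<close>

text \<open>The step from \<open>g\<close> to \<open>G\<close> is the harder one. Closeness of two
  sums of \<open>g\<close> controls the distance of two points, while a zonotope contains every
  sub-sum and every weighted sum of its generators; what closes the gap is that integrability
  constrains all admissible taggings at once. Moreover the integral of \<open>G\<close> has to be
  produced, so the argument runs through a Cauchy criterion, and since gauges and partitions are
  directed by refinement rather than indexed by integers, the criterion is stated for a base of sets
  of sums.

  The Birkhoff case meets two more obstacles. A tag must lie in its cell, so the tags of one
  partition are in general not admissible for a common refinement with another; but a tag of a fine
  cell is admissible for the coarse cell around it. Hence all sums over refinements of
  \<open>P0\<close> are compared with one fixed sum over \<open>P0\<close>. And the Minkowski sums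
  are infinite: limits are approximated by finite zonotopes, in which finitely many fine cells fill
  a coarse cell only up to a small defect of measure.\<close>

lemma ckD:
  assumes "A \<in> ck"
  shows "A \<noteq> {}" "convex A" "compact A" "bounded A" "closed A"
  using assms by (auto simp: ck_def compact_imp_bounded compact_imp_closed)

lemma hausdorff_dist_commute: "hausdorff_dist A B = hausdorff_dist B A"
  by (simp add: hausdorff_dist_def max.commute)

lemma hausdorff_dist_le:
  assumes "A \<noteq> {}" "B \<noteq> {}"
    and "\<And>a. a \<in> A \<Longrightarrow> \<exists>b\<in>B. dist a b \<le> r"
    and "\<And>b. b \<in> B \<Longrightarrow> \<exists>a\<in>A. dist b a \<le> r"
  shows "hausdorff_dist A B \<le> r"
proof -
  have "infdist a B \<le> r" if "a \<in> A" for a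
    using assms(3)[OF that] infdist_le2 by blast
  moreover have "infdist b A \<le> r" if "b \<in> B" for b
    using assms(4)[OF that] infdist_le2 by blast
  ultimately show ?thesis
    using assms(1,2) by (simp add: hausdorff_dist_def cSUP_least)
qed

text \<open>Compactness of \<open>B\<close> provides a nearest point; compactness of
  \<open>A\<close> bounds the supremum, so that it really dominates each \<open>infdist a B\<close>.
  Later consequences of a small Hausdorff distance are drawn through such matching points.\<close>

lemma hausdorff_dist_attained:
  assumes A: "A \<in> ck" and B: "B \<in> ck" and a: "a \<in> A"
  obtains b where "b \<in> B" "dist a b \<le> hausdorff_dist A B"
proof -
  obtain b where b: "b \<in> B" "\<And>y. y \<in> B \<Longrightarrow> dist a b \<le> dist a y"
    using continuous_attains_inf[of B "dist a"] ckD[OF B] by (metis continuous_on_dist[OF continuous_on_const continuous_on_id])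
  have "dist a b \<le> infdist a B"
    using b by (auto simp: infdist_def intro!: cINF_greatest)
  also have "\<dots> \<le> (SUP a\<in>A. infdist a B)"
  proof (rule cSUP_upper[OF a])
    have "compact ((\<lambda>a. infdist a B) ` A)"
      using ckD[OF A] by (intro compact_continuous_image continuous_intros) auto
    then show "bdd_above ((\<lambda>a. infdist a B) ` A)"
      by (simp add: bounded_imp_bdd_above compact_imp_bounded)
  qed
  also have "\<dots> \<le> hausdorff_dist A B"
    by (simp add: hausdorff_dist_def)
  finally show thesis using b that by blast
qed

lemma hausdorff_dist_nonneg:
  assumes "A \<in> ck" "B \<in> ck"
  shows "0 \<le> hausdorff_dist A B"
proof -
  obtain a where "a \<in> A" using ckD(1)[OF assms(1)] by blast
  then show ?thesis
    using hausdorff_dist_attained[OF assms] by (meson order_trans zero_le_dist)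
qed

lemma hausdorff_dist_refl: "A \<noteq> {} \<Longrightarrow> hausdorff_dist A A = 0"
  by (simp add: hausdorff_dist_def)

lemma hausdorff_dist_triangle:
  assumes A: "A \<in> ck" and B: "B \<in> ck" and C: "C \<in> ck"
  shows "hausdorff_dist A C \<le> hausdorff_dist A B + hausdorff_dist B C"
proof -
  have *: "\<exists>c\<in>C. dist a c \<le> hausdorff_dist A B + hausdorff_dist B C"
    if A: "A \<in> ck" and C: "C \<in> ck" and "a \<in> A" for a and A C :: "'a set"
  proof -
    obtain b where b: "b \<in> B" "dist a b \<le> hausdorff_dist A B"
      using hausdorff_dist_attained[OF A B \<open>a \<in> A\<close>] .
    obtain c where c: "c \<in> C" "dist b c \<le> hausdorff_dist B C"
      using hausdorff_dist_attained[OF B C b(1)] .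
    show ?thesis
      using b c dist_triangle[of a c b] by (intro bexI[of _ c]) auto
  qed
  show ?thesis
    using *[OF A C] *[OF C A] ckD(1)[OF A] ckD(1)[OF C]
    by (intro hausdorff_dist_le) (auto simp: hausdorff_dist_commute add.commute)
qed

lemma hausdorff_dist_triangle2:
  assumes "A \<in> ck" "B \<in> ck" "C \<in> ck" "hausdorff_dist B A \<le> r" "hausdorff_dist B C \<le> s"
  shows "hausdorff_dist A C \<le> r + s"
  using hausdorff_dist_triangle[of A B C] assms by (simp add: hausdorff_dist_commute)

text \<open>The limit is the intersection of the closed neighbourhoods of the \<open>C n\<close>
  whose radii bound the tails of \<open>\<Sum>n. (1/2)^n\<close>.\<close>

lemma ck_fast_Cauchy_limit:
  fixes C :: "nat \<Rightarrow> 'a::banach set"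
  assumes C: "\<And>n. C n \<in> ck"
    and fast: "\<And>n. hausdorff_dist (C n) (C (Suc n)) \<le> (1/2)^n"
  obtains \<Phi> where "\<Phi> \<in> ck" "\<And>n. hausdorff_dist \<Phi> (C n) \<le> 2 * (1/2)^n"
proof -
  define N where "N n = C n + cball 0 (2 * (1/2)^n)" for n
  define \<Phi> where "\<Phi> = (\<Inter>n. N n)"
  have half_pow: "0 \<le> (1/2::real)^n" for n
    by simp
  \<comment> \<open>The ball is not compact in infinite dimension; compactness of \<open>C n\<close>
    is what keeps the sum closed.\<close>
  have closed_N: "closed (N n)" for n
    using compact_closed_sums[OF ckD(3)[OF C] closed_cball[of 0 "2 * (1/2)^n"], of n]
    unfolding N_def by (rule back_subst[of closed]) (auto simp: set_plus_def)
  have convex_N: "convex (N n)" for n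
    unfolding N_def by (intro convex_set_plus ckD(2)[OF C] convex_cball)
  have N_I: "x \<in> N n" if "c \<in> C n" "dist x c \<le> 2 * (1/2)^n" for x c n
    using set_plus_intro[OF that(1), of "x - c" "cball 0 (2 * (1/2)^n)"] that(2)
    by (simp add: N_def dist_norm norm_minus_commute)
  have \<Phi>_near: "\<exists>c\<in>C n. dist x c \<le> 2 * (1/2)^n" if "x \<in> \<Phi>" for x n
  proof -
    have "x \<in> C n + cball 0 (2 * (1/2)^n)"
      using that by (auto simp: \<Phi>_def N_def)
    then show ?thesis
      by (force simp: dist_norm elim!: set_plus_elim)
  qed
  \<comment> \<open>The bound is the geometric sum of the steps from \<open>k\<close> to
    \<open>k + j\<close>, kept exact so that the induction closes.\<close>
  have tail: "hausdorff_dist (C k) (C (k + j)) \<le> 2 * (1/2)^k - 2 * (1/2)^(k + j)" for k j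
  proof (induction j)
    case 0
    show ?case by (simp add: hausdorff_dist_refl ckD(1)[OF C])
  next
    case (Suc j)
    then show ?case
      using hausdorff_dist_triangle[OF C[of k] C[of "k+j"] C[of "Suc (k+j)"]] fast[of "k+j"]
      by simp
  qed
  have near_\<Phi>: "\<exists>x\<in>\<Phi>. dist a x \<le> 2 * (1/2)^n" if a: "a \<in> C n" for a n
  proof -
    \<comment> \<open>Dependent choice builds a chain that starts at \<open>a\<close> and moves from
      each set to a near point of the next; the clause on \<open>j = 0\<close> carries the starting
      point.\<close>
    have "\<exists>y. \<forall>j. (y j \<in> C (n + j) \<and> (j = 0 \<longrightarrow> y j = a)) \<and> dist (y j) (y (Suc j)) \<le> (1/2)^(n + j)"
    proof (rule dependent_nat_choice)
      show "\<exists>x. x \<in> C (n + 0) \<and> (0 = 0 \<longrightarrow> x = a)"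
        using a by simp
    next
      fix x j assume x: "x \<in> C (n + j) \<and> (j = 0 \<longrightarrow> x = a)"
      obtain b where "b \<in> C (Suc (n + j))" "dist x b \<le> hausdorff_dist (C (n+j)) (C (Suc (n+j)))"
        using hausdorff_dist_attained[OF C C] x by blast
      then show "\<exists>y. (y \<in> C (n + Suc j) \<and> (Suc j = 0 \<longrightarrow> y = a)) \<and> dist x y \<le> (1/2)^(n + j)"
        using fast[of "n + j"] by (auto intro!: exI[of _ b])
    qed
    then obtain y where y: "\<And>j. y j \<in> C (n + j)" "y 0 = a"
      "\<And>j. dist (y j) (y (Suc j)) \<le> (1/2)^(n + j)" by blast
    have yd: "dist (y i) (y (i + j)) \<le> 2 * (1/2)^(n+i) - 2 * (1/2)^(n+i+j)" for i j
    proof (induction j)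
      case (Suc j)
      then show ?case
        using dist_triangle[of "y i" "y (Suc (i+j))" "y (i+j)"] y(3)[of "i+j"]
        by (simp add: add.assoc)
    qed simp
    have yd': "dist (y i) (y j) \<le> 2 * (1/2)^i" if "i \<le> j" for i j
    proof -
      have "dist (y i) (y j) \<le> 2 * (1/2)^(n+i)"
        using yd[of i "j - i"] that by (auto intro: order_trans)
      also have "\<dots> \<le> 2 * (1/2)^i"
        by (simp add: power_decreasing)
      finally show ?thesis .
    qed
    have "Cauchy y"
    proof (rule metric_CauchyI)
      fix e :: real assume "e > 0"
      then obtain M where M: "(1/2)^M < e/4"
        using real_arch_pow_inv[of "e/4" "1/2"] by auto
      have "dist (y i) (y j) < e" if "i \<ge> M" "j \<ge> M" for i j
        using dist_triangle3[of "y i" "y j" "y M"] yd'[OF that(1)] yd'[OF that(2)] M by linarith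
      then show "\<exists>M. \<forall>m\<ge>M. \<forall>n\<ge>M. dist (y m) (y n) < e" by blast
    qed
    then obtain x where x: "y \<longlonglongrightarrow> x"
      using Cauchy_convergent_iff convergent_def by blast
    \<comment> \<open>The chain is seen to lie in \<open>N k\<close> from \<open>j \<ge> k\<close>
      on, where \<open>tail\<close> applies; as \<open>N k\<close> is closed, this suffices for the
      limit.\<close>
    have "x \<in> N k" for k
    proof (rule Lim_in_closed_set[OF closed_N _ _ x])
      have "y j \<in> N k" if "j \<ge> k" for j
      proof -
        obtain c where "c \<in> C k" "dist (y j) c \<le> hausdorff_dist (C (n+j)) (C k)"
          using hausdorff_dist_attained[OF C C y(1)] .
        moreover have "hausdorff_dist (C (n+j)) (C k) \<le> 2 * (1/2)^k"
          using tail[of k "n+j-k"] that by (auto simp: hausdorff_dist_commute intro: order_trans)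
        ultimately show ?thesis using N_I by auto
      qed
      then show "\<forall>\<^sub>F j in sequentially. y j \<in> N k"
        by (auto simp: eventually_sequentially)
    qed simp
    moreover have "dist a x \<le> 2 * (1/2)^n"
    proof (rule tendsto_upperbound)
      show "(\<lambda>j. dist a (y j)) \<longlonglongrightarrow> dist a x"
        by (intro tendsto_intros x)
      show "\<forall>\<^sub>F j in sequentially. dist a (y j) \<le> 2 * (1/2)^n"
      proof (intro always_eventually allI)
        fix j
        have "dist a (y j) \<le> 2 * (1/2)^n - 2 * (1/2)^(n + j)"
          using yd[of 0 j] y(2) by simp
        then show "dist a (y j) \<le> 2 * (1/2)^n"
          using half_pow[of "n + j"] by linarith
      qed
    qed simp
    ultimately show ?thesis by (auto simp: \<Phi>_def)
  qed
  \<comment> \<open>A finite \<open>e/2\<close>-net of a single \<open>C n\<close> is an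
    \<open>e\<close>-net of \<Phi>, because points of \<Phi> lie within
    \<open>2 * (1/2)^n < e/2\<close> of \<open>C n\<close>.\<close>
  have "compact \<Phi>"
    unfolding compact_eq_totally_bounded
  proof (intro conjI allI impI)
    show "complete \<Phi>"
      using closed_N by (auto simp: \<Phi>_def complete_eq_closed)
    fix e :: real assume "e > 0"
    then obtain n where n: "(1/2)^n < e/4"
      using real_arch_pow_inv[of "e/4" "1/2"] by auto
    obtain k where k: "finite k" "C n \<subseteq> (\<Union>x\<in>k. ball x (e/2))"
      using ckD(3)[OF C[of n]] \<open>e > 0\<close> unfolding compact_eq_totally_bounded
      by (meson half_gt_zero)
    have "\<Phi> \<subseteq> (\<Union>x\<in>k. ball x e)"
    proof
      fix x assume "x \<in> \<Phi>"
      then obtain c where c: "c \<in> C n" "dist x c \<le> 2 * (1/2)^n"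
        using \<Phi>_near by blast
      then obtain z where "z \<in> k" "dist z c < e/2"
        using k by force
      then show "x \<in> (\<Union>x\<in>k. ball x e)"
        using c n dist_triangle2[of z x c] by (intro UN_I[of z]) auto
    qed
    with k show "\<exists>k. finite k \<and> \<Phi> \<subseteq> (\<Union>x\<in>k. ball x e)" by blast
  qed
  moreover have "\<Phi> \<noteq> {}"
    using near_\<Phi> ckD(1)[OF C[of 0]] by blast
  moreover have "convex \<Phi>"
    unfolding \<Phi>_def using convex_N by (intro convex_INT)
  ultimately have \<Phi>: "\<Phi> \<in> ck" by (simp add: ck_def)
  have "hausdorff_dist \<Phi> (C n) \<le> 2 * (1/2)^n" for n
    using \<Phi>_near near_\<Phi> ckD(1)[OF C] ckD(1)[OF \<Phi>] by (intro hausdorff_dist_le) auto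
  with \<Phi> that show thesis by blast
qed

text \<open>Completeness in the form that suits gauges and partitions: the members of
  \<open>\<Q>\<close> play the role of the tails of a net of compact sets. Pairwise meeting replaces
  nesting, since a common member of two tails is enough to link points chosen from each.\<close>

lemma ck_Cauchy_base_limit:
  fixes \<Q> :: "'a::banach set set set"
  assumes ck: "\<And>Q. Q \<in> \<Q> \<Longrightarrow> Q \<subseteq> ck"
    and meet: "\<And>Q R. Q \<in> \<Q> \<Longrightarrow> R \<in> \<Q> \<Longrightarrow> Q \<inter> R \<noteq> {}"
    and small: "\<And>\<epsilon>. \<epsilon> > 0 \<Longrightarrow> \<exists>Q\<in>\<Q>. \<forall>S\<in>Q. \<forall>T\<in>Q. hausdorff_dist S T \<le> \<epsilon>"
  obtains \<Phi> where "\<Phi> \<in> ck" "\<And>\<epsilon>. \<epsilon> > 0 \<Longrightarrow> \<exists>Q\<in>\<Q>. \<forall>S\<in>Q. hausdorff_dist \<Phi> S \<le> \<epsilon>"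
proof -
  \<comment> \<open>The extra half is there because \<open>C n\<close> and \<open>C (Suc n)\<close>
    are compared through a common member of \<open>Q n\<close> and \<open>Q (Suc n)\<close>, and the
    two errors must add up to at most \<open>(1/2)^n\<close>.\<close>
  have "\<exists>Q\<in>\<Q>. \<forall>S\<in>Q. \<forall>T\<in>Q. hausdorff_dist S T \<le> (1/2)^n / 2" for n
    by (rule small) simp
  then obtain Q where Q: "\<And>n. Q n \<in> \<Q>"
    and dQ: "\<And>n S T. S \<in> Q n \<Longrightarrow> T \<in> Q n \<Longrightarrow> hausdorff_dist S T \<le> (1/2)^n / 2"
    by metis
  have "\<exists>S. S \<in> Q n" for n
    using meet[OF Q Q, of n n] by blast
  then obtain C where C: "\<And>n. C n \<in> Q n"
    by metis
  have C_ck: "C n \<in> ck" for n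
    using C Q ck by blast
  have "hausdorff_dist (C n) (C (Suc n)) \<le> (1/2)^n" for n
  proof -
    obtain S where S: "S \<in> Q n" "S \<in> Q (Suc n)"
      using meet[OF Q Q, of n "Suc n"] by blast
    then have "S \<in> ck" using Q ck by blast
    then have "hausdorff_dist (C n) (C (Suc n)) \<le> (1/2)^n / 2 + (1/2)^Suc n / 2"
      by (intro hausdorff_dist_triangle2[OF C_ck _ C_ck, where B = S] dQ S C)
    also have "\<dots> \<le> (1/2)^n" by simp
    finally show ?thesis .
  qed
  then obtain \<Phi> where \<Phi>: "\<Phi> \<in> ck" "\<And>n. hausdorff_dist \<Phi> (C n) \<le> 2 * (1/2)^n"
    using ck_fast_Cauchy_limit[of C] C_ck by blast
  have "\<exists>Q\<in>\<Q>. \<forall>S\<in>Q. hausdorff_dist \<Phi> S \<le> \<epsilon>" if "\<epsilon> > 0" for \<epsilon>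
  proof -
    \<comment> \<open>The final estimate \<open>2 * (1/2)^n + (1/2)^n / 2\<close> is at most
      \<open>3 * (1/2)^n\<close>.\<close>
    obtain n where n: "(1/2)^n < \<epsilon>/3"
      using real_arch_pow_inv[of "\<epsilon>/3" "1/2"] \<open>\<epsilon> > 0\<close> by auto
    have "hausdorff_dist \<Phi> S \<le> \<epsilon>" if "S \<in> Q n" for S
    proof -
      have "hausdorff_dist \<Phi> S \<le> 2 * (1/2)^n + (1/2)^n / 2"
        using that \<Phi> dQ[OF C that] Q ck C_ck
        by (intro hausdorff_dist_triangle2[where B = "C n"]) (auto simp: hausdorff_dist_commute)
      moreover have "0 \<le> (1/2::real)^n" by simp
      ultimately show ?thesis using n by linarith
    qed
    with Q show ?thesis by blast
  qed
  with \<Phi> that show thesis by blast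
qed

subsection \<open>Symmetric sets and zonotopes\<close>

text \<open>The vector \<open>s\<close> is twice the centre of symmetry; this way the vector
  belonging to a zonotope is the plain sum of its generators.\<close>

definition centered :: "'a::ab_group_add set \<Rightarrow> 'a \<Rightarrow> bool" where
  "centered S s \<longleftrightarrow> (\<forall>x\<in>S. s - x \<in> S)"

text \<open>Reflecting in \<open>S\<close> and then in \<open>T\<close> translates \<open>S\<close> by \<open>s - t\<close> and moves it into its own
  \<open>2 d\<close>-neighbourhood; after \<open>n\<close> rounds, boundedness of \<open>S\<close> forces \<open>norm (s - t) \<le> 2 d\<close>.\<close>

lemma centered_dist_le:
  assumes S: "S \<in> ck" and T: "T \<in> ck" and s: "centered S s" and t: "centered T t"
  shows "norm (s - t) \<le> 2 * hausdorff_dist S T"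
proof -
  define d where "d = hausdorff_dist S T"
  have step: "\<exists>y\<in>S. norm (x + (s - t) - y) \<le> 2 * d" if "x \<in> S" for x
  proof -
    obtain b where b: "b \<in> T" "dist x b \<le> d"
      using hausdorff_dist_attained[OF S T \<open>x \<in> S\<close>] by (auto simp: d_def)
    then have "t - b \<in> T" using t by (simp add: centered_def)
    then obtain a where a: "a \<in> S" "dist (t - b) a \<le> d"
      using hausdorff_dist_attained[OF T S] by (auto simp: d_def hausdorff_dist_commute)
    have "norm (x + (s - t) - (s - a)) = norm ((x - b) - ((t - b) - a))"
      by (simp add: algebra_simps)
    also have "\<dots> \<le> norm (x - b) + norm (t - b - a)"
      by (rule norm_triangle_ineq4)
    also have "\<dots> \<le> 2 * d"
      using a b by (simp add: dist_norm)
    finally have "norm (x + (s - t) - (s - a)) \<le> 2 * d" .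
    moreover have "s - a \<in> S"
      using a(1) s by (simp add: centered_def)
    ultimately show ?thesis by blast
  qed
  obtain x where x: "x \<in> S" using ckD(1)[OF S] by blast
  obtain B where B: "\<And>y. y \<in> S \<Longrightarrow> norm y \<le> B"
    using ckD(4)[OF S] by (auto simp: bounded_iff)
  have iter: "\<exists>y\<in>S. norm (x + real n *\<^sub>R (s - t) - y) \<le> real n * (2 * d)" for n
  proof (induction n)
    case 0
    show ?case using x by (intro bexI[of _ x]) auto
  next
    case (Suc n)
    then obtain y where y: "y \<in> S" "norm (x + real n *\<^sub>R (s - t) - y) \<le> real n * (2 * d)"
      by blast
    obtain z where z: "z \<in> S" "norm (y + (s - t) - z) \<le> 2 * d"
      using step[OF y(1)] by blast
    have "norm (x + real (Suc n) *\<^sub>R (s - t) - z)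
        = norm ((x + real n *\<^sub>R (s - t) - y) + (y + (s - t) - z))"
      by (simp add: algebra_simps)
    also have "\<dots> \<le> real n * (2 * d) + 2 * d"
      using norm_triangle_mono[OF y(2) z(2)] .
    finally show ?case using z(1) by (intro bexI[of _ z]) (simp_all add: algebra_simps)
  qed
  have lin: "real n * (norm (s - t) - 2 * d) \<le> 2 * B" for n
  proof -
    obtain y where y: "y \<in> S" "norm (x + real n *\<^sub>R (s - t) - y) \<le> real n * (2 * d)"
      using iter by blast
    have "real n * norm (s - t) = norm ((x + real n *\<^sub>R (s - t) - y) + y - x)"
      by simp
    also have "\<dots> \<le> norm (x + real n *\<^sub>R (s - t) - y) + norm y + norm x"
      by (meson add_right_mono norm_triangle_ineq norm_triangle_ineq4 order_trans)
    also have "\<dots> \<le> real n * (2 * d) + B + B"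
      using y(2) B[OF y(1)] B[OF x] by linarith
    finally show ?thesis by (simp add: algebra_simps)
  qed
  show ?thesis
  proof (rule ccontr)
    assume "\<not> ?thesis"
    then have "0 < norm (s - t) - 2 * d" by (simp add: d_def)
    then obtain n where "2 * B < real n * (norm (s - t) - 2 * d)"
      using reals_Archimedean3 by blast
    with lin[of n] show False by simp
  qed
qed

text \<open>By \<open>centered_dist_le\<close> the vectors \<open>s n\<close> of the approximating
  sets form a Cauchy sequence, and since \<Phi> is closed the reflections pass to the limit. The
  vector obtained is the later candidate for the integral of \<open>g\<close>.\<close>

lemma centered_limit:
  fixes \<Phi> :: "'a::banach set"
  assumes \<Phi>: "\<Phi> \<in> ck"
    and approx: "\<And>\<epsilon>. \<epsilon> > 0 \<Longrightarrow> \<exists>S\<in>ck. \<exists>s. centered S s \<and> hausdorff_dist \<Phi> S \<le> \<epsilon>"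
  obtains \<phi> where "centered \<Phi> \<phi>"
proof -
  have "\<exists>S s. S \<in> ck \<and> centered S s \<and> hausdorff_dist \<Phi> S \<le> inverse (real (Suc n))" for n
    using approx[of "inverse (real (Suc n))"] by auto
  then obtain S s where S: "\<And>n. S n \<in> ck" "\<And>n. centered (S n) (s n)"
    and d: "\<And>n. hausdorff_dist \<Phi> (S n) \<le> inverse (real (Suc n))" by metis
  have sd: "norm (s m - s n) \<le> 2 * (inverse (real (Suc m)) + inverse (real (Suc n)))" for m n
    using centered_dist_le[OF S(1) S(1) S(2) S(2), of m n]
      hausdorff_dist_triangle2[OF S(1) \<Phi> S(1) d d, of m n] by (meson mult_left_mono order_trans zero_le_numeral)
  have "Cauchy s"
  proof (rule CauchyI)
    fix e :: real assume "0 < e"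
    then obtain M where M: "inverse (real (Suc M)) < e / 4"
      using reals_Archimedean[of "e/4"] by auto
    have "norm (s m - s n) < e" if "m \<ge> M" "n \<ge> M" for m n
    proof -
      have "inverse (real (Suc m)) \<le> inverse (real (Suc M))"
        "inverse (real (Suc n)) \<le> inverse (real (Suc M))"
        using that by (auto intro!: le_imp_inverse_le)
      with sd[of m n] M show ?thesis by argo
    qed
    then show "\<exists>M. \<forall>m\<ge>M. \<forall>n\<ge>M. norm (s m - s n) < e" by blast
  qed
  then obtain \<phi> where \<phi>: "s \<longlonglongrightarrow> \<phi>"
    using Cauchy_convergent_iff convergent_def by blast
  have "\<phi> - x \<in> \<Phi>" if x: "x \<in> \<Phi>" for x
  proof -
    \<comment> \<open>The point is carried from \<Phi> into \<open>S n\<close>, reflected there, and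
      carried back, at a cost of one Hausdorff distance each way.\<close>
    have "\<exists>b\<in>\<Phi>. norm (b - (s n - x)) \<le> 2 * inverse (real (Suc n))" for n
    proof -
      obtain a where a: "a \<in> S n" "dist x a \<le> hausdorff_dist \<Phi> (S n)"
        using hausdorff_dist_attained[OF \<Phi> S(1) x] .
      have "s n - a \<in> S n"
        using S(2) a by (auto simp: centered_def)
      then obtain b where b: "b \<in> \<Phi>" "dist (s n - a) b \<le> hausdorff_dist \<Phi> (S n)"
        using hausdorff_dist_attained[OF S(1) \<Phi>] by (metis hausdorff_dist_commute)
      have "norm (b - (s n - x)) = norm ((x - a) - (s n - a - b))"
        by (simp add: algebra_simps)
      also have "\<dots> \<le> norm (x - a) + norm (s n - a - b)"
        by (rule norm_triangle_ineq4)
      also have "\<dots> \<le> 2 * inverse (real (Suc n))"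
        using a(2) b(2) d[of n] by (simp add: dist_norm)
      finally show ?thesis using b by blast
    qed
    then obtain b where b: "\<And>n. b n \<in> \<Phi>"
      "\<And>n. norm (b n - (s n - x)) \<le> 2 * inverse (real (Suc n))" by metis
    have "(\<lambda>n. 2 * inverse (real (Suc n))) \<longlonglongrightarrow> 0"
      using tendsto_mult_right_zero[OF LIMSEQ_inverse_real_of_nat] .
    then have "(\<lambda>n. b n - (s n - x)) \<longlonglongrightarrow> 0"
      by (rule Lim_null_comparison[rotated]) (use b in auto)
    then have "(\<lambda>n. (b n - (s n - x)) + (s n - x)) \<longlonglongrightarrow> 0 + (\<phi> - x)"
      by (intro tendsto_intros \<phi>)
    then have "b \<longlonglongrightarrow> \<phi> - x" by simp
    with ckD(5)[OF \<Phi>] b(1) show ?thesis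
      using closed_sequentially by blast
  qed
  with that show thesis by (auto simp: centered_def)
qed

section \<open>Zonotopes and their Hausdorff distances\<close>

definition zonotope :: "'i set \<Rightarrow> ('i \<Rightarrow> 'a::real_normed_vector) \<Rightarrow> 'a set" where
  "zonotope I v = (\<Sum>i\<in>I. closed_segment 0 (v i))"

lemma mem_zonotope:
  assumes "finite I"
  shows "x \<in> zonotope I v \<longleftrightarrow> (\<exists>c. (\<forall>i\<in>I. c i \<in> {0..1}) \<and> x = (\<Sum>i\<in>I. c i *\<^sub>R v i))"
proof
  assume "x \<in> zonotope I v"
  then obtain y where y: "x = sum y I" "\<forall>i\<in>I. y i \<in> closed_segment 0 (v i)"
    using assms by (auto simp: zonotope_def set_sum_alt)
  then have "\<forall>i\<in>I. \<exists>u. u \<in> {0..1} \<and> y i = u *\<^sub>R v i"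
    by (auto simp: closed_segment_def)
  then obtain c where "\<forall>i\<in>I. c i \<in> {0..1} \<and> y i = c i *\<^sub>R v i"
    by metis
  with y show "\<exists>c. (\<forall>i\<in>I. c i \<in> {0..1}) \<and> x = (\<Sum>i\<in>I. c i *\<^sub>R v i)"
    by (intro exI[of _ c]) auto
next
  assume "\<exists>c. (\<forall>i\<in>I. c i \<in> {0..1}) \<and> x = (\<Sum>i\<in>I. c i *\<^sub>R v i)"
  then show "x \<in> zonotope I v"
    using assms by (fastforce simp: zonotope_def set_sum_alt closed_segment_def)
qed

lemma zonotope_in_ck: "zonotope I v \<in> ck"
proof (cases "finite I")
  case True
  then show ?thesis
  proof (induction I rule: finite_induct)
    case empty
    show ?case by (simp add: zonotope_def ck_def)
  next
    case (insert i I)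
    let ?s = "closed_segment 0 (v i)"
    have "compact (?s + zonotope I v)"
      using compact_sums[of ?s "zonotope I v"] ckD(3)[OF insert.IH]
      by (simp add: set_plus_def Bex_def conj_assoc) (smt (verit) Collect_cong)
    moreover have "convex (?s + zonotope I v)"
      using ckD(2)[OF insert.IH] by (intro convex_set_plus) auto
    moreover have "?s + zonotope I v \<noteq> {}"
      using ckD(1)[OF insert.IH] by (auto simp: set_plus_def)
    ultimately show ?case
      using insert.hyps by (simp add: zonotope_def ck_def)
  qed
\<comment> \<open>For infinite \<open>I\<close> the sum is by convention the zero \<open>{0}\<close>
  of the Minkowski monoid.\<close>
qed (simp add: zonotope_def ck_def)

text \<open>The reflection replaces every coefficient \<open>c i\<close> by
  \<open>1 - c i\<close>.\<close>

lemma centered_zonotope: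
  assumes "finite I"
  shows "centered (zonotope I v) (sum v I)"
  unfolding centered_def
proof
  fix x assume "x \<in> zonotope I v"
  then obtain c where c: "\<forall>i\<in>I. c i \<in> {0..1}" "x = (\<Sum>i\<in>I. c i *\<^sub>R v i)"
    using assms by (auto simp: mem_zonotope)
  have "sum v I - x = (\<Sum>i\<in>I. (1 - c i) *\<^sub>R v i)"
    by (simp add: c sum_subtractf algebra_simps)
  then show "sum v I - x \<in> zonotope I v"
    unfolding mem_zonotope[OF assms] using c(1) by (intro exI[of _ "\<lambda>i. 1 - c i"]) auto
qed

text \<open>Convex hulls commute with Minkowski sums and a ball is convex. Thus a bound for all
  selections of points extends to convex combinations, with weights chosen independently in each
  summand.\<close>

lemma norm_sum_convex_hull_le:
  assumes "finite I"
    and bound: "\<And>y. (\<And>i. i \<in> I \<Longrightarrow> y i \<in> V i) \<Longrightarrow> norm (\<Sum>i\<in>I. y i) \<le> B"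
    and x: "\<And>i. i \<in> I \<Longrightarrow> x i \<in> convex hull (V i)"
  shows "norm (\<Sum>i\<in>I. x i) \<le> B"
proof -
  have "(\<Sum>i\<in>I. x i) \<in> (\<Sum>i\<in>I. convex hull (V i))"
    using assms by (auto simp: set_sum_alt)
  also have "\<dots> = convex hull (\<Sum>i\<in>I. V i)"
    by (simp add: convex_hull_set_sum)
  also have "\<dots> \<subseteq> cball 0 B"
    using bound \<open>finite I\<close> by (intro hull_minimal) (auto simp: set_sum_alt)
  finally show ?thesis by simp
qed

text \<open>Selections from the pairs \<open>{0, v i}\<close> give exactly the sub-sums, and the
  hull of such a pair is the segment of the multiples \<open>c i *\<^sub>R v i\<close>.\<close>

lemma norm_weighted_sum_le:
  assumes "finite I"
    and bound: "\<And>K. K \<subseteq> I \<Longrightarrow> norm (sum v K) \<le> B"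
    and c: "\<And>i. i \<in> I \<Longrightarrow> c i \<in> {0..1}"
  shows "norm (\<Sum>i\<in>I. c i *\<^sub>R v i) \<le> B"
proof (rule norm_sum_convex_hull_le[OF \<open>finite I\<close>, where V = "\<lambda>i. {0, v i}"])
  fix y assume y: "\<And>i. i \<in> I \<Longrightarrow> y i \<in> {0, v i}"
  have "(\<Sum>i\<in>I. y i) = (\<Sum>i\<in>{i\<in>I. y i \<noteq> 0}. y i)"
    by (rule sum.mono_neutral_right) (use \<open>finite I\<close> in auto)
  also have "\<dots> = sum v {i\<in>I. y i \<noteq> 0}"
    using y by (intro sum.cong) auto
  finally show "norm (\<Sum>i\<in>I. y i) \<le> B"
    using bound[of "{i\<in>I. y i \<noteq> 0}"] by auto
next
  fix i assume "i \<in> I"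
  then show "c i *\<^sub>R v i \<in> convex hull {0, v i}"
    using c[of i] by (auto simp: closed_segment_def simp flip: segment_convex_hull)
qed

text \<open>Points of the two zonotopes with the same coefficients are matched. The hypothesis is
  kept in weighted form because for Birkhoff sums the weighted sums over fine cells are estimated
  directly.\<close>

lemma hausdorff_dist_zonotope_le_weighted:
  assumes "finite I"
    and bound: "\<And>c. (\<And>i. i \<in> I \<Longrightarrow> c i \<in> {0..1}) \<Longrightarrow> norm (\<Sum>i\<in>I. c i *\<^sub>R (u i - v i)) \<le> B"
  shows "hausdorff_dist (zonotope I u) (zonotope I v) \<le> B"
proof -
  have *: "\<exists>y\<in>zonotope I v. dist x y \<le> B"
    if x: "x \<in> zonotope I u" and
      bound: "\<And>c. (\<And>i. i \<in> I \<Longrightarrow> c i \<in> {0..1}) \<Longrightarrow> norm (\<Sum>i\<in>I. c i *\<^sub>R (u i - v i)) \<le> B"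
      for x u v
  proof -
    obtain c where c: "\<forall>i\<in>I. c i \<in> {0..1}" "x = (\<Sum>i\<in>I. c i *\<^sub>R u i)"
      using assms(1) x by (auto simp: mem_zonotope)
    have "dist x (\<Sum>i\<in>I. c i *\<^sub>R v i) \<le> B"
      using bound[of c] c by (simp add: dist_norm algebra_simps sum_subtractf)
    then show ?thesis
      using c mem_zonotope[OF assms(1)] by blast
  qed
  have "norm (\<Sum>i\<in>I. c i *\<^sub>R (v i - u i)) \<le> B" if "\<And>i. i \<in> I \<Longrightarrow> c i \<in> {0..1}" for c
    using bound[OF that] by (simp add: algebra_simps sum_subtractf norm_minus_commute)
  with bound show ?thesis
    by (intro hausdorff_dist_le ckD(1) zonotope_in_ck *) auto
qed

lemma hausdorff_dist_zonotope_le: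
  assumes "finite I"
    and "\<And>K. K \<subseteq> I \<Longrightarrow> norm (\<Sum>i\<in>K. u i - v i) \<le> B"
  shows "hausdorff_dist (zonotope I u) (zonotope I v) \<le> B"
  by (intro hausdorff_dist_zonotope_le_weighted norm_weighted_sum_le assms)

text \<open>Nonnegative factors keep all segments on one side of 0, so their lengths add. Hence
  cutting a cell into pieces with the same tag does not change the zonotope.\<close>

lemma zonotope_parallel:
  assumes "finite I" and "\<And>i. i \<in> I \<Longrightarrow> 0 \<le> a i"
  shows "zonotope I (\<lambda>i. a i *\<^sub>R x) = closed_segment 0 (sum a I *\<^sub>R x)"
  using assms
proof (induction I rule: finite_induct)
  case empty
  show ?case by (simp add: zonotope_def)
next
  case (insert i I)
  have seg: "closed_segment 0 (r *\<^sub>R x) = (\<lambda>r. r *\<^sub>R x) ` {0..r}" if "0 \<le> r" for r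
  proof -
    have "{0..r} = (\<lambda>u. u * r) ` {0..1}"
      using that by (simp add: image_mult_atLeastAtMost_if')
    then show ?thesis
      by (auto simp: closed_segment_def image_image)
  qed
  have "closed_segment 0 (a i *\<^sub>R x) + closed_segment 0 (b *\<^sub>R x) = closed_segment 0 ((a i + b) *\<^sub>R x)"
    if "0 \<le> b" for b
  proof -
    have ai: "0 \<le> a i" using insert.prems by simp
    have "r *\<^sub>R x \<in> (\<lambda>r. r *\<^sub>R x) ` {0..a i} + (\<lambda>r. r *\<^sub>R x) ` {0..b}"
      if "r \<in> {0..a i + b}" for r
    proof -
      \<comment> \<open>Greedy splitting: as much of \<open>r\<close> as possible is taken from the
        first segment, and the remainder fits into \<open>{0..b}\<close>.\<close>
      have "r *\<^sub>R x = min r (a i) *\<^sub>R x + (r - min r (a i)) *\<^sub>R x"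
        by (simp flip: scaleR_add_left)
      with that ai \<open>0 \<le> b\<close> show ?thesis
        by (simp only:) (intro set_plus_intro imageI; auto)
    qed
    moreover have "r *\<^sub>R x + r' *\<^sub>R x \<in> (\<lambda>r. r *\<^sub>R x) ` {0..a i + b}"
      if "r \<in> {0..a i}" "r' \<in> {0..b}" for r r'
      using that by (intro image_eqI[of _ _ "r + r'"]) (auto simp: scaleR_add_left)
    ultimately show ?thesis
      using ai \<open>0 \<le> b\<close> by (auto simp: seg elim!: set_plus_elim)
  qed
  from this[of "sum a I"] show ?case
    using insert by (simp add: zonotope_def sum_nonneg)
qed

text \<open>Intended for \<open>h\<close> sending a fine cell to the coarse cell around it, with
  \<open>x j\<close> the value at the tag of the coarse cell \<open>j\<close>.\<close>

lemma zonotope_group: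
  assumes "finite I" "finite J" "h ` I \<subseteq> J" and "\<And>i. i \<in> I \<Longrightarrow> 0 \<le> a i"
  shows "zonotope I (\<lambda>i. a i *\<^sub>R x (h i)) = zonotope J (\<lambda>j. (\<Sum>i\<in>{i\<in>I. h i = j}. a i) *\<^sub>R x j)"
proof -
  have "zonotope I (\<lambda>i. a i *\<^sub>R x (h i)) = (\<Sum>j\<in>J. zonotope {i\<in>I. h i = j} (\<lambda>i. a i *\<^sub>R x (h i)))"
    unfolding zonotope_def by (rule sum.group[OF assms(1-3), symmetric])
  also have "\<dots> = (\<Sum>j\<in>J. zonotope {i\<in>I. h i = j} (\<lambda>i. a i *\<^sub>R x j))"
    by (auto simp: zonotope_def intro!: sum.cong)
  also have "\<dots> = zonotope J (\<lambda>j. (\<Sum>i\<in>{i\<in>I. h i = j}. a i) *\<^sub>R x j)"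
    unfolding zonotope_def[of J]
    using assms by (intro sum.cong refl zonotope_parallel) auto
  finally show ?thesis .
qed

subsection \<open>McShane integrals\<close>

lemma free_tagged_partition_finite: "free_tagged_partition p \<Longrightarrow> finite p"
  by (simp add: free_tagged_partition_def)

lemma free_tagged_partitionD:
  assumes "free_tagged_partition p" "i \<in> p"
  shows "fst i \<in> {0..1}" "snd i \<subseteq> {0..1}" "\<exists>a b. a \<le> b \<and> snd i = {a..b}"
  using assms unfolding free_tagged_partition_def case_prod_unfold by blast+

lemma free_tagged_partition_interior:
  assumes "free_tagged_partition p" "i \<in> p" "j \<in> p" "i \<noteq> j"
  shows "interior (snd i) \<inter> interior (snd j) = {}"
proof -
  have "\<forall>i\<in>p. \<forall>j\<in>p. i \<noteq> j \<longrightarrow> interior (snd i) \<inter> interior (snd j) = {}"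
    using assms(1) by (simp add: free_tagged_partition_def case_prod_unfold prod_eq_iff)
  with assms show ?thesis by blast
qed

lemma free_tagged_partition_Union:
  assumes "free_tagged_partition p"
  shows "(\<Union>i\<in>p. snd i) = {0..1}"
  using assms by (simp add: free_tagged_partition_def case_prod_unfold)

text \<open>Cousin's lemma even gives tags inside their intervals. Existence keeps the tails of the
  net of Riemann sums nonempty.\<close>

lemma free_tagged_partition_fine_exists:
  assumes "\<forall>t\<in>{0..1}. \<delta> t > 0"
  obtains p where "free_tagged_partition p" "(\<lambda>t. {t - \<delta> t<..<t + \<delta> t}) fine p"
proof -
  \<comment> \<open>A gauge lives on the whole line, while \<open>\<delta>\<close> is known to be
    positive only on \<open>{0..1}\<close>; the radius 1 elsewhere is a filler.\<close>
  define \<gamma> :: "real \<Rightarrow> real set"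
    where "\<gamma> t = (if t \<in> {0..1} then {t - \<delta> t<..<t + \<delta> t} else {t - 1<..<t + 1})" for t
  have "gauge \<gamma>"
    using assms by (auto simp: gauge_def \<gamma>_def)
  then obtain p where p: "p tagged_division_of {0..1}" "\<gamma> fine p"
    using fine_division_exists_real by blast
  have tag: "t \<in> I" "I \<subseteq> {0..1}" "\<exists>a b. a \<le> b \<and> I = {a..b}" if "(t, I) \<in> p" for t I
    using tagged_division_ofD(2-4)[OF p(1) that]
    by (simp_all del: atLeastAtMost_iff, metis atLeastatMost_empty_iff2 box_real(2) empty_iff)
  have "\<forall>(t, I)\<in>p. t \<in> {0..1} \<and> I \<subseteq> {0..1} \<and> (\<exists>a b. a \<le> b \<and> I = {a..b})"
  proof (rule ballI, rule case_prodI2)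
    fix i t I assume "i \<in> p" "i = (t, I)"
    then have "(t, I) \<in> p" by simp
    from tag[OF this] show "t \<in> {0..1} \<and> I \<subseteq> {0..1} \<and> (\<exists>a b. a \<le> b \<and> I = {a..b})"
      by blast
  qed
  moreover have "\<forall>(t, I)\<in>p. \<forall>(t', I')\<in>p. (t, I) \<noteq> (t', I') \<longrightarrow> interior I \<inter> interior I' = {}"
    using tagged_division_ofD(5)[OF p(1)] by blast
  moreover have "finite p" using p(1) by blast
  moreover have "(\<Union>(t, I)\<in>p. I) = {0..1}"
    using tagged_division_ofD(6)[OF p(1)] by blast
  ultimately have "free_tagged_partition p"
    by (simp only: free_tagged_partition_def simp_thms)
  moreover have "(\<lambda>t. {t - \<delta> t<..<t + \<delta> t}) fine p"
  proof (rule fineI)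
    fix t I assume tI: "(t, I) \<in> p"
    have "t \<in> {0..1}" using tag(1,2)[OF tI] by blast
    with fineD[OF p(2) tI] show "I \<subseteq> {t - \<delta> t<..<t + \<delta> t}"
      by (simp add: \<gamma>_def del: atLeastAtMost_iff)
  qed
  ultimately show thesis using that by blast
qed

section \<open>Common refinements of partitions with free tags\<close>

lemma negligible_Int_atLeastAtMost:
  fixes a b c d :: real
  assumes "interior {a..b} \<inter> interior {c..d} = {}"
  shows "negligible ({a..b} \<inter> {c..d})"
proof -
  have "box (max a c) (min b d) = {}"
    using assms by auto
  then have "negligible (cbox (max a c) (min b d))"
    by (simp only: negligible_interval)
  then show ?thesis by simp
qed

lemma measure_lborel_split_free_tagged_partition:
  assumes q: "free_tagged_partition q" and I: "{a..b} \<subseteq> {0..1}"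
  shows "measure lborel {a..b} = (\<Sum>j\<in>q. measure lborel ({a..b} \<inter> snd j))"
proof -
  have cl: "{a..b} \<inter> snd j \<in> sets borel" if "j \<in> q" for j
    using free_tagged_partitionD(3)[OF q that] by auto
  have "{a..b} = (\<Union>j\<in>q. {a..b} \<inter> snd j)"
    using free_tagged_partition_Union[OF q] I by blast
  then have "measure lebesgue {a..b} = measure lebesgue (\<Union>j\<in>q. {a..b} \<inter> snd j)"
    by simp
  \<comment> \<open>Additivity up to null sets: distinct cells of \<open>q\<close>, degenerate ones
    included, overlap in a null set.\<close>
  also have "\<dots> = (\<Sum>j\<in>q. measure lebesgue ({a..b} \<inter> snd j))"
  proof (rule measure_negligible_finite_Union_image[OF free_tagged_partition_finite[OF q]])
    fix j assume "j \<in> q"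
    then show "{a..b} \<inter> snd j \<in> lmeasurable"
      using free_tagged_partitionD(3)[OF q] by (metis Int_atLeastAtMost box_real(2) lmeasurable_cbox)
  next
    show "pairwise (\<lambda>i j. negligible (({a..b} \<inter> snd i) \<inter> ({a..b} \<inter> snd j))) q"
    proof (rule pairwiseI)
      fix i j assume ij: "i \<in> q" "j \<in> q" "i \<noteq> j"
      have "negligible (snd i \<inter> snd j)"
        using free_tagged_partition_interior[OF q ij] free_tagged_partitionD(3)[OF q]
          negligible_Int_atLeastAtMost ij by metis
      then show "negligible (({a..b} \<inter> snd i) \<inter> ({a..b} \<inter> snd j))"
        by (rule negligible_subset) auto
    qed
  qed
  also have "\<dots> = (\<Sum>j\<in>q. measure lborel ({a..b} \<inter> snd j))"
    using cl by (intro sum.cong) (auto simp: measure_completion)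
  finally show ?thesis by (simp add: measure_completion)
qed

text \<open>Coinciding cells of the common refinement are degenerate, hence the Riemann sum
  does not see whether the refinement is read as a family or as a set.\<close>

lemma free_tagged_partition_refine:
  fixes g :: "real \<Rightarrow> 'a::real_normed_vector"
  assumes p: "free_tagged_partition p" "d fine p"
    and q: "free_tagged_partition q" "d fine q"
    and \<tau>: "\<And>i j. i \<in> p \<Longrightarrow> j \<in> q \<Longrightarrow> \<tau> (i, j) \<in> {fst i, fst j}"
  obtains r where "free_tagged_partition r" "d fine r"
    "(\<Sum>(t, I)\<in>r. measure lborel I *\<^sub>R g t)
      = (\<Sum>k\<in>p \<times> q. measure lborel (snd (fst k) \<inter> snd (snd k)) *\<^sub>R g (\<tau> k))"
proof -
  define c where "c k = snd (fst k) \<inter> snd (snd k)"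
    for k :: "(real \<times> real set) \<times> (real \<times> real set)"
  \<comment> \<open>Empty intersections are discarded because a cell must be some
    \<open>{a..b}\<close> with \<open>a \<le> b\<close>; having measure zero, they return when the
    sum is extended to \<open>p \<times> q\<close>.\<close>
  define K where "K = {k \<in> p \<times> q. c k \<noteq> {}}"
  define r where "r = (\<lambda>k. (\<tau> k, c k)) ` K"
  have fin: "finite (p \<times> q)"
    using p q by (simp add: free_tagged_partition_finite)
  then have "finite K" by (simp add: K_def)
  have KD: "fst k \<in> p" "snd k \<in> q" "c k \<noteq> {}" if "k \<in> K" for k
    using that by (auto simp: K_def)
  have \<tau>K: "\<tau> k \<in> {fst (fst k), fst (snd k)}" if "k \<in> K" for k
    using \<tau>[OF KD(1,2)[OF that]] by simp
  have disj: "interior (c k) \<inter> interior (c l) = {}" if "k \<in> K" "l \<in> K" "k \<noteq> l" for k l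
  proof (cases "fst k = fst l")
    case True
    then have "snd k \<noteq> snd l" using that by (simp add: prod_eq_iff)
    then show ?thesis
      using free_tagged_partition_interior[OF q(1) KD(2) KD(2), OF that(1,2)]
      by (auto simp: c_def)
  next
    case False
    then show ?thesis
      using free_tagged_partition_interior[OF p(1) KD(1) KD(1), OF that(1,2)]
      by (auto simp: c_def)
  qed
  have c_ivl: "\<exists>a b. a \<le> b \<and> c k = {a..b}" if k: "k \<in> K" for k
  proof -
    obtain a b a' b' where "snd (fst k) = {a..b}" "snd (snd k) = {a'..b'}"
      using free_tagged_partitionD(3)[OF p(1) KD(1)[OF k]]
        free_tagged_partitionD(3)[OF q(1) KD(2)[OF k]] by blast
    then have "c k = {max a a'..min b b'}" by (simp add: c_def)
    with KD(3)[OF k] show ?thesis by fastforce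
  qed
  have deg: "measure lborel (c k) = 0" if k: "k \<in> K" and "l \<in> K" "k \<noteq> l" "c k = c l" for k l
  proof -
    obtain a b where ab: "a \<le> b" "c k = {a..b}" using c_ivl[OF k] by blast
    have "interior (c k) = {}" using disj[OF that(1-3)] that(4) by simp
    then have "a = b" using ab by simp
    then show ?thesis using ab by simp
  qed
  have "free_tagged_partition r"
    unfolding free_tagged_partition_def
  proof (intro conjI)
    show "finite r" using \<open>finite K\<close> by (simp add: r_def)
    show "\<forall>(t, I)\<in>r. t \<in> {0..1} \<and> I \<subseteq> {0..1} \<and> (\<exists>a b. a \<le> b \<and> I = {a..b})"
    proof (clarsimp simp: r_def simp del: atLeastAtMost_iff)
      fix i s j t assume k: "((i, s), (j, t)) \<in> K"
      show "\<tau> ((i, s), j, t) \<in> {0..1} \<and> c ((i, s), j, t) \<subseteq> {0..1}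
          \<and> (\<exists>a b. a \<le> b \<and> c ((i, s), j, t) = {a..b})"
        using \<tau>K[OF k] c_ivl[OF k] free_tagged_partitionD(1,2)[OF p(1) KD(1)[OF k]]
          free_tagged_partitionD(1,2)[OF q(1) KD(2)[OF k]]
        by (intro conjI) (auto simp: c_def)
    qed
    show "\<forall>(t, I)\<in>r. \<forall>(t', I')\<in>r. (t, I) \<noteq> (t', I') \<longrightarrow> interior I \<inter> interior I' = {}"
      using disj by (fastforce simp: r_def)
    have "x \<in> (\<Union>k\<in>K. c k)" if "x \<in> {0..1}" for x
    proof -
      obtain i j where "i \<in> p" "x \<in> snd i" "j \<in> q" "x \<in> snd j"
        using \<open>x \<in> {0..1}\<close>
        unfolding free_tagged_partition_Union[OF p(1), symmetric]
        by (metis UN_E free_tagged_partition_Union[OF p(1)] free_tagged_partition_Union[OF q(1)])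
      then have "(i, j) \<in> K" "x \<in> c (i, j)" by (auto simp: K_def c_def)
      then show ?thesis by blast
    qed
    moreover have "c k \<subseteq> {0..1}" if "k \<in> K" for k
      using free_tagged_partitionD(2)[OF p(1) KD(1)[OF that]] by (auto simp: c_def)
    ultimately have "(\<Union>k\<in>K. c k) = {0..1}" by blast
    then show "(\<Union>(t, I)\<in>r. I) = {0..1}"
      by (simp add: r_def)
  qed
  moreover have "d fine r"
  proof (rule fineI)
    fix t I assume "(t, I) \<in> r"
    then obtain k where k: "k \<in> K" "t = \<tau> k" "I = c k" by (auto simp: r_def)
    \<comment> \<open>The new cell lies in both original intervals, so it is fine for whichever of
      the two tags \<open>\<tau>\<close> selects; no condition ties the tag to the cell
      itself.\<close>
    have "snd (fst k) \<subseteq> d (fst (fst k))" "snd (snd k) \<subseteq> d (fst (snd k))"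
      using KD(1,2)[OF k(1)] p(2) q(2) by (metis fineD prod.collapse)+
    then show "I \<subseteq> d t"
      using \<tau>K[OF k(1)] k by (auto simp: c_def)
  qed
  moreover have "(\<Sum>(t, I)\<in>r. measure lborel I *\<^sub>R g t) = (\<Sum>k\<in>p \<times> q. measure lborel (c k) *\<^sub>R g (\<tau> k))"
  proof -
    have "(\<Sum>(t, I)\<in>r. measure lborel I *\<^sub>R g t) = (\<Sum>k\<in>K. measure lborel (c k) *\<^sub>R g (\<tau> k))"
      unfolding r_def using deg
      by (subst sum.reindex_nontrivial[OF \<open>finite K\<close>]) auto
    also have "\<dots> = (\<Sum>k\<in>p \<times> q. measure lborel (c k) *\<^sub>R g (\<tau> k))"
      using fin by (intro sum.mono_neutral_left) (auto simp: K_def)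
    finally show ?thesis .
  qed
  ultimately show thesis using that by (simp add: c_def)
qed

section \<open>Riemann zonotopes\<close>

abbreviation riemann_zonotope ::
    "(real \<Rightarrow> 'a::real_normed_vector) \<Rightarrow> (real \<times> real set) set \<Rightarrow> 'a set" where
  "riemann_zonotope g p \<equiv> zonotope p (\<lambda>(t, I). measure lborel I *\<^sub>R g t)"

lemma scaleR_segment_image:
  "(\<lambda>x. r *\<^sub>R x) ` (convex hull {0, v}) = closed_segment 0 (r *\<^sub>R v)"
  using closed_segment_linear_image[of "(*\<^sub>R) r" 0 v]
  by (simp add: segment_convex_hull linear_scaleR)

text \<open>Cutting a cell along \<open>q\<close> while keeping its tag splits its segment into
  parallel ones, which add up again. This puts the zonotopes of \<open>p\<close> and
  \<open>q\<close> on a common index set.\<close>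

lemma riemann_zonotope_split:
  fixes g :: "real \<Rightarrow> 'a::real_normed_vector"
  assumes p: "free_tagged_partition p" and q: "free_tagged_partition q"
  shows "riemann_zonotope g p
    = zonotope (p \<times> q) (\<lambda>k. measure lborel (snd (fst k) \<inter> snd (snd k)) *\<^sub>R g (fst (fst k)))"
proof -
  have "closed_segment 0 (measure lborel I *\<^sub>R g t)
      = (\<Sum>j\<in>q. closed_segment 0 (measure lborel (I \<inter> snd j) *\<^sub>R g t))" if tI: "(t, I) \<in> p" for t I
  proof -
    obtain a b where "I = {a..b}" "{a..b} \<subseteq> {0..1}"
      using free_tagged_partitionD(2,3)[OF p tI] by auto
    then show ?thesis
      using zonotope_parallel[OF free_tagged_partition_finite[OF q],
          of "\<lambda>j. measure lborel (I \<inter> snd j)" "g t"]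
        measure_lborel_split_free_tagged_partition[OF q, of a b]
      by (simp add: zonotope_def)
  qed
  then show ?thesis
    by (auto simp: zonotope_def sum.cartesian_product' intro!: sum.cong)
qed

lemma riemann_zonotope_close:
  fixes g :: "real \<Rightarrow> 'a::real_normed_vector"
  assumes p: "free_tagged_partition p" "d fine p"
    and q: "free_tagged_partition q" "d fine q"
    and close: "\<And>p. free_tagged_partition p \<Longrightarrow> d fine p \<Longrightarrow>
      norm (\<phi> - (\<Sum>(t, I)\<in>p. measure lborel I *\<^sub>R g t)) \<le> \<epsilon>"
  shows "hausdorff_dist (riemann_zonotope g p) (riemann_zonotope g q) \<le> 2 * \<epsilon>"
proof -
  define w where "w k = measure lborel (snd (fst k) \<inter> snd (snd k))"
    for k :: "(real \<times> real set) \<times> (real \<times> real set)"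
  have fin: "finite (p \<times> q)"
    using p q by (simp add: free_tagged_partition_finite)
  have "riemann_zonotope g q = zonotope (q \<times> p) (\<lambda>k. w k *\<^sub>R g (fst (fst k)))"
    using riemann_zonotope_split[OF q(1) p(1)] by (simp add: w_def)
  also have "\<dots> = zonotope (p \<times> q) (\<lambda>k. w k *\<^sub>R g (fst (snd k)))"
    unfolding zonotope_def
    by (rule sum.reindex_bij_witness[of _ prod.swap prod.swap]) (auto simp: w_def Int_commute)
  finally have zq: "riemann_zonotope g q = \<dots>" .
  have zp: "riemann_zonotope g p = zonotope (p \<times> q) (\<lambda>k. w k *\<^sub>R g (fst (fst k)))"
    using riemann_zonotope_split[OF p(1) q(1)] by (simp add: w_def)
  show ?thesis
    unfolding zp zq
  proof (rule hausdorff_dist_zonotope_le[OF fin])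
    fix K assume K: "K \<subseteq> p \<times> q"
    \<comment> \<open>\<open>\<tau>\<close> follows \<open>p\<close> on \<open>K\<close> and
      \<open>q\<close> elsewhere, \<open>\<sigma>\<close> follows \<open>q\<close> throughout; the
      two Riemann sums differ exactly by the partial sum over \<open>K\<close>.\<close>
    define \<tau> where "\<tau> k = (if k \<in> K then fst (fst k) else fst (snd k))" for k
    define \<sigma> where "\<sigma> k = fst (snd k)"
      for k :: "(real \<times> real set) \<times> (real \<times> real set)"
    obtain r where r: "free_tagged_partition r" "d fine r"
      "(\<Sum>(t, I)\<in>r. measure lborel I *\<^sub>R g t) = (\<Sum>k\<in>p \<times> q. w k *\<^sub>R g (\<tau> k))"
      by (rule free_tagged_partition_refine[OF p q, of \<tau> g]) (auto simp: \<tau>_def w_def)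
    obtain s where s: "free_tagged_partition s" "d fine s"
      "(\<Sum>(t, I)\<in>s. measure lborel I *\<^sub>R g t) = (\<Sum>k\<in>p \<times> q. w k *\<^sub>R g (\<sigma> k))"
      by (rule free_tagged_partition_refine[OF p q, of \<sigma> g]) (auto simp: \<sigma>_def w_def)
    have "(\<Sum>k\<in>K. w k *\<^sub>R g (fst (fst k)) - w k *\<^sub>R g (fst (snd k)))
        = (\<Sum>k\<in>p \<times> q. w k *\<^sub>R g (\<tau> k) - w k *\<^sub>R g (\<sigma> k))"
      using K fin by (intro sum.mono_neutral_cong_left) (auto simp: \<tau>_def \<sigma>_def)
    also have "\<dots> = (\<phi> - (\<Sum>(t, I)\<in>s. measure lborel I *\<^sub>R g t)) - (\<phi> - (\<Sum>(t, I)\<in>r. measure lborel I *\<^sub>R g t))"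
      unfolding r(3) s(3) by (simp add: sum_subtractf)
    also have "norm \<dots> \<le> 2 * \<epsilon>"
      using norm_triangle_le_diff[OF add_mono[OF close[OF s(1,2)] close[OF r(1,2)]]] by simp
    finally show "norm (\<Sum>k\<in>K. w k *\<^sub>R g (fst (fst k)) - w k *\<^sub>R g (fst (snd k))) \<le> 2 * \<epsilon>" .
  qed
qed

lemma minkowski_riemann_sum:
  fixes g :: "real \<Rightarrow> 'a::real_normed_vector"
  assumes G: "\<forall>t\<in>{0..1}. G t = convex hull {0, g t}" and p: "free_tagged_partition p"
  shows "(\<Sum>(t, I)\<in>p. (\<lambda>x. measure lborel I *\<^sub>R x) ` G t) = riemann_zonotope g p"
  unfolding zonotope_def
proof (rule sum.cong[OF refl])
  fix i assume "i \<in> p"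
  then show "(case i of (t, I) \<Rightarrow> (\<lambda>x. measure lborel I *\<^sub>R x) ` G t)
      = closed_segment 0 (case i of (t, I) \<Rightarrow> measure lborel I *\<^sub>R g t)"
    using bspec[OF G free_tagged_partitionD(1)[OF p]]
    by (simp add: scaleR_segment_image split_beta)
qed

section \<open>The two McShane implications\<close>

lemma McShane_integrable_if_multi:
  fixes g :: "real \<Rightarrow> 'a::banach"
  assumes G: "\<forall>t\<in>{0..1}. G t = convex hull {0, g t}" and int: "McShane_integrable_multi G"
  shows "McShane_integrable g"
proof -
  obtain \<Phi> where \<Phi>: "\<Phi> \<in> ck" and gauge: "\<And>\<epsilon>. \<epsilon> > 0 \<Longrightarrow> \<exists>\<delta> :: real \<Rightarrow> real. (\<forall>t\<in>{0..1}. \<delta> t > 0) \<and>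
        (\<forall>p. free_tagged_partition p \<and> (\<lambda>t. {t - \<delta> t<..<t + \<delta> t}) fine p \<longrightarrow>
           hausdorff_dist \<Phi> (\<Sum>(t, I)\<in>p. (\<lambda>x. measure lborel I *\<^sub>R x) ` G t) < \<epsilon>)"
    using int unfolding McShane_integrable_multi_def by blast
  have gauge: "\<exists>\<delta> :: real \<Rightarrow> real. (\<forall>t\<in>{0..1}. \<delta> t > 0) \<and>
        (\<forall>p. free_tagged_partition p \<and> (\<lambda>t. {t - \<delta> t<..<t + \<delta> t}) fine p \<longrightarrow>
           hausdorff_dist \<Phi> (riemann_zonotope g p) < \<epsilon>)" if "\<epsilon> > 0" for \<epsilon>
    using gauge[OF that] by (simp add: minkowski_riemann_sum[OF G] cong: conj_cong)
  have cen: "centered (riemann_zonotope g p) (\<Sum>(t, I)\<in>p. measure lborel I *\<^sub>R g t)"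
    if "free_tagged_partition p" for p
    using that by (intro centered_zonotope free_tagged_partition_finite)
  have "\<exists>S\<in>ck. \<exists>s. centered S s \<and> hausdorff_dist \<Phi> S \<le> \<epsilon>" if "\<epsilon> > 0" for \<epsilon>
  proof -
    obtain \<delta> :: "real \<Rightarrow> real" where \<delta>: "\<forall>t\<in>{0..1}. \<delta> t > 0"
      "\<And>p. free_tagged_partition p \<Longrightarrow> (\<lambda>t. {t - \<delta> t<..<t + \<delta> t}) fine p \<Longrightarrow>
           hausdorff_dist \<Phi> (riemann_zonotope g p) < \<epsilon>"
      using gauge[OF \<open>\<epsilon> > 0\<close>] by blast
    obtain p where "free_tagged_partition p" "(\<lambda>t. {t - \<delta> t<..<t + \<delta> t}) fine p"
      using free_tagged_partition_fine_exists[OF \<delta>(1)] .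
    with \<delta>(2) cen zonotope_in_ck show ?thesis by (meson less_imp_le)
  qed
  then obtain \<phi> where \<phi>: "centered \<Phi> \<phi>"
    using centered_limit[OF \<Phi>] by blast
  show ?thesis
    unfolding McShane_integrable_def
  proof (intro exI[of _ \<phi>] allI impI)
    fix \<epsilon> :: real assume "\<epsilon> > 0"
    \<comment> \<open>Half of \<epsilon> absorbs the factor 2 of
      \<open>centered_dist_le\<close>.\<close>
    then obtain \<delta> :: "real \<Rightarrow> real" where \<delta>: "\<forall>t\<in>{0..1}. \<delta> t > 0"
      "\<And>p. free_tagged_partition p \<Longrightarrow> (\<lambda>t. {t - \<delta> t<..<t + \<delta> t}) fine p \<Longrightarrow>
           hausdorff_dist \<Phi> (riemann_zonotope g p) < \<epsilon>/2"
      using gauge[of "\<epsilon>/2"] by auto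
    have "norm (\<phi> - (\<Sum>(t, I)\<in>p. measure lborel I *\<^sub>R g t)) < \<epsilon>"
      if "free_tagged_partition p" "(\<lambda>t. {t - \<delta> t<..<t + \<delta> t}) fine p" for p
      using centered_dist_le[OF \<Phi> zonotope_in_ck \<phi> cen[OF that(1)]] \<delta>(2)[OF that] by linarith
    with \<delta>(1) show "\<exists>\<delta>. (\<forall>t\<in>{0..1}. 0 < \<delta> t) \<and> (\<forall>p. free_tagged_partition p \<and>
        (\<lambda>t. {t - \<delta> t<..<t + \<delta> t}) fine p \<longrightarrow>
        norm (\<phi> - (\<Sum>(t, I)\<in>p. measure lborel I *\<^sub>R g t)) < \<epsilon>)" by blast
  qed
qed

lemma McShane_integrable_multi_if:
  fixes g :: "real \<Rightarrow> 'a::banach"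
  assumes G: "\<forall>t\<in>{0..1}. G t = convex hull {0, g t}" and int: "McShane_integrable g"
  shows "McShane_integrable_multi G"
proof -
  obtain \<phi> where gauge: "\<And>\<epsilon>. \<epsilon> > 0 \<Longrightarrow> \<exists>\<delta> :: real \<Rightarrow> real. (\<forall>t\<in>{0..1}. \<delta> t > 0) \<and>
        (\<forall>p. free_tagged_partition p \<and> (\<lambda>t. {t - \<delta> t<..<t + \<delta> t}) fine p \<longrightarrow>
           norm (\<phi> - (\<Sum>(t, I)\<in>p. measure lborel I *\<^sub>R g t)) < \<epsilon>)"
    using int unfolding McShane_integrable_def by blast
  \<comment> \<open>The sets \<open>Z \<delta>\<close> are the tails of the net of Riemann zonotopes
    directed by gauges.\<close>
  define Z where "Z \<delta> = riemann_zonotope g `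
    {p. free_tagged_partition p \<and> (\<lambda>t. {t - \<delta> t<..<t + \<delta> t}) fine p}" for \<delta>
  define \<Q> where "\<Q> = Z ` {\<delta>. \<forall>t\<in>{0..1}. \<delta> t > 0}"
  obtain \<Phi> where \<Phi>: "\<Phi> \<in> ck" "\<And>\<epsilon>. \<epsilon> > 0 \<Longrightarrow> \<exists>Q\<in>\<Q>. \<forall>S\<in>Q. hausdorff_dist \<Phi> S \<le> \<epsilon>"
  proof (rule ck_Cauchy_base_limit[of \<Q>])
    fix Q assume "Q \<in> \<Q>"
    then show "Q \<subseteq> ck" by (auto simp: \<Q>_def Z_def zonotope_in_ck)
  next
    fix Q R assume "Q \<in> \<Q>" "R \<in> \<Q>"
    then obtain \<delta> \<eta> where \<delta>: "\<forall>t\<in>{0..1}. \<delta> t > 0" "Q = Z \<delta>"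
      and \<eta>: "\<forall>t\<in>{0..1}. \<eta> t > 0" "R = Z \<eta>"
      by (auto simp: \<Q>_def)
    \<comment> \<open>A partition fine for the pointwise minimum is fine for both gauges, so its
      zonotope lies in both tails.\<close>
    have "\<forall>t\<in>{0..1}. min (\<delta> t) (\<eta> t) > 0"
      using \<delta> \<eta> by simp
    then obtain p where p: "free_tagged_partition p"
      "(\<lambda>t. {t - min (\<delta> t) (\<eta> t)<..<t + min (\<delta> t) (\<eta> t)}) fine p"
      by (rule free_tagged_partition_fine_exists)
    have "riemann_zonotope g p \<in> Z \<zeta>" if "\<And>t. min (\<delta> t) (\<eta> t) \<le> \<zeta> t" for \<zeta>
    proof -
      have "(\<lambda>t. {t - \<zeta> t<..<t + \<zeta> t}) fine p"
      proof (rule fineI)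
        fix t I assume "(t, I) \<in> p"
        then have "I \<subseteq> {t - min (\<delta> t) (\<eta> t)<..<t + min (\<delta> t) (\<eta> t)}"
          using p(2) fineD by fastforce
        also have "\<dots> \<subseteq> {t - \<zeta> t<..<t + \<zeta> t}"
          using that[of t] by (intro greaterThanLessThan_subseteq_greaterThanLessThan[THEN iffD2]) linarith
        finally show "I \<subseteq> {t - \<zeta> t<..<t + \<zeta> t}" .
      qed
      with p(1) show ?thesis by (auto simp: Z_def)
    qed
    from this[of \<delta>] this[of \<eta>] show "Q \<inter> R \<noteq> {}"
      using \<delta>(2) \<eta>(2) by auto
  next
    fix \<epsilon> :: real assume "\<epsilon> > 0"
    \<comment> \<open>Half of \<epsilon> absorbs the factor 2 of
      \<open>riemann_zonotope_close\<close>.\<close>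
    then obtain \<delta> :: "real \<Rightarrow> real" where \<delta>: "\<forall>t\<in>{0..1}. \<delta> t > 0"
      "\<And>p. free_tagged_partition p \<Longrightarrow> (\<lambda>t. {t - \<delta> t<..<t + \<delta> t}) fine p \<Longrightarrow>
           norm (\<phi> - (\<Sum>(t, I)\<in>p. measure lborel I *\<^sub>R g t)) < \<epsilon>/2"
      using gauge[of "\<epsilon>/2"] by auto
    have "\<forall>S\<in>Z \<delta>. \<forall>T\<in>Z \<delta>. hausdorff_dist S T \<le> \<epsilon>"
    proof (clarsimp simp: Z_def)
      fix p q
      assume "free_tagged_partition p" "(\<lambda>t. {t - \<delta> t<..<t + \<delta> t}) fine p"
        "free_tagged_partition q" "(\<lambda>t. {t - \<delta> t<..<t + \<delta> t}) fine q"
      from riemann_zonotope_close[OF this less_imp_le[OF \<delta>(2)]]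
      show "hausdorff_dist (riemann_zonotope g p) (riemann_zonotope g q) \<le> \<epsilon>" by simp
    qed
    with \<delta>(1) show "\<exists>Q\<in>\<Q>. \<forall>S\<in>Q. \<forall>T\<in>Q. hausdorff_dist S T \<le> \<epsilon>"
      by (auto simp: \<Q>_def)
  qed blast
  show ?thesis
    unfolding McShane_integrable_multi_def
  proof (intro bexI[of _ \<Phi>] allI impI)
    fix \<epsilon> :: real assume "\<epsilon> > 0"
    then obtain \<delta> where \<delta>: "\<forall>t\<in>{0..1}. \<delta> t > 0" "\<forall>S\<in>Z \<delta>. hausdorff_dist \<Phi> S \<le> \<epsilon>/2"
      using \<Phi>(2)[of "\<epsilon>/2"] by (auto simp: \<Q>_def)
    have "hausdorff_dist \<Phi> (\<Sum>(t, I)\<in>p. (\<lambda>x. measure lborel I *\<^sub>R x) ` G t) < \<epsilon>"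
      if "free_tagged_partition p" "(\<lambda>t. {t - \<delta> t<..<t + \<delta> t}) fine p" for p
    proof -
      have "riemann_zonotope g p \<in> Z \<delta>" using that by (auto simp: Z_def)
      then have "hausdorff_dist \<Phi> (riemann_zonotope g p) \<le> \<epsilon>/2" using \<delta>(2) by blast
      with \<open>\<epsilon> > 0\<close> show ?thesis
        by (simp add: minkowski_riemann_sum[OF G that(1)])
    qed
    with \<delta>(1) show "\<exists>\<delta>. (\<forall>t\<in>{0..1}. 0 < \<delta> t) \<and> (\<forall>p. free_tagged_partition p \<and>
        (\<lambda>t. {t - \<delta> t<..<t + \<delta> t}) fine p \<longrightarrow>
        hausdorff_dist \<Phi> (\<Sum>(t, I)\<in>p. (\<lambda>x. measure lborel I *\<^sub>R x) ` G t) < \<epsilon>)" by blast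
  qed (fact \<Phi>(1))
qed

subsection \<open>Birkhoff integrals\<close>

text \<open>The Cauchy criterion for unconditional convergence. It bounds every finite sub-sum
  outside \<open>E0\<close>, and zonotopes require precisely such control over arbitrary
  sub-sums.\<close>

lemma has_sum_tail_le:
  fixes v :: "'i \<Rightarrow> 'a::real_normed_vector"
  assumes "(v has_sum s) P" and "e > 0"
  shows "\<exists>E0. finite E0 \<and> E0 \<subseteq> P \<and>
    (\<forall>K. finite K \<and> K \<subseteq> P \<and> K \<inter> E0 = {} \<longrightarrow> norm (sum v K) \<le> e)"
proof -
  have "\<forall>\<^sub>F E in finite_subsets_at_top P. dist (sum v E) s < e/2"
    using assms tendstoD[of "sum v" s _ "e/2"] by (simp add: has_sum_def)
  then obtain E0 where E0: "finite E0" "E0 \<subseteq> P"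
    "\<And>E. finite E \<Longrightarrow> E0 \<subseteq> E \<Longrightarrow> E \<subseteq> P \<Longrightarrow> dist (sum v E) s < e/2"
    unfolding eventually_finite_subsets_at_top by metis
  have "norm (sum v K) \<le> e" if K: "finite K" "K \<subseteq> P" "K \<inter> E0 = {}" for K
  proof -
    have "norm (sum v K) = dist (sum v (E0 \<union> K)) (sum v E0)"
      using E0(1) K by (simp add: sum.union_disjoint Int_commute dist_norm)
    also have "\<dots> \<le> dist (sum v (E0 \<union> K)) s + dist (sum v E0) s"
      by (rule dist_triangle2)
    also have "\<dots> \<le> e"
      using E0(3)[of "E0 \<union> K"] E0(3)[of E0] E0(1,2) K by simp
    finally show ?thesis .
  qed
  with E0(1,2) show ?thesis by (intro exI[of _ E0] conjI allI impI) simp_all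
qed

text \<open>The smaller zonotope is padded with zero generators to the index set \<open>E\<close>;
  the differences of generators then live outside \<open>E0\<close>.\<close>

lemma hausdorff_dist_zonotope_superset_le:
  assumes "finite E" "E0 \<subseteq> E" and "\<And>K. K \<subseteq> E - E0 \<Longrightarrow> norm (sum v K) \<le> B"
  shows "hausdorff_dist (zonotope E v) (zonotope E0 v) \<le> B"
proof -
  define u where "u i = (if i \<in> E0 then v i else 0)" for i
  have "zonotope E0 v = zonotope E u"
    unfolding zonotope_def using assms(1,2)
    by (intro sum.mono_neutral_cong_left) (auto simp: u_def)
  moreover have "hausdorff_dist (zonotope E v) (zonotope E u) \<le> B"
  proof (rule hausdorff_dist_zonotope_le[OF assms(1)])
    fix K assume K: "K \<subseteq> E"
    have "(\<Sum>i\<in>K. v i - u i) = sum v (K - E0)"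
      using finite_subset[OF K assms(1)]
      by (intro sum.mono_neutral_cong_right) (auto simp: u_def)
    then show "norm (\<Sum>i\<in>K. v i - u i) \<le> B"
      using assms(3)[of "K - E0"] K by auto
  qed
  ultimately show ?thesis by simp
qed

text \<open>Finite zonotopes beyond \<open>E0\<close> differ little because all sub-sums outside
  \<open>E0\<close> are small, so they form a Cauchy net; completeness of \<open>ck\<close> supplies
  the limit.\<close>

lemma zonotope_converges_if_has_sum:
  fixes v :: "'i \<Rightarrow> 'a::banach"
  assumes "(v has_sum s) P"
  obtains S where "S \<in> ck" "((\<lambda>E. hausdorff_dist S (zonotope E v)) \<longlongrightarrow> 0) (finite_subsets_at_top P)"
proof -
  define Z where "Z E0 = (\<lambda>E. zonotope E v) ` {E. finite E \<and> E0 \<subseteq> E \<and> E \<subseteq> P}" for E0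
  define \<Q> where "\<Q> = Z ` {E0. finite E0 \<and> E0 \<subseteq> P}"
  obtain S where S: "S \<in> ck" "\<And>\<epsilon>. \<epsilon> > 0 \<Longrightarrow> \<exists>Q\<in>\<Q>. \<forall>T\<in>Q. hausdorff_dist S T \<le> \<epsilon>"
  proof (rule ck_Cauchy_base_limit[of \<Q>])
    fix Q assume "Q \<in> \<Q>"
    then show "Q \<subseteq> ck" by (auto simp: \<Q>_def Z_def zonotope_in_ck)
  next
    fix Q R assume "Q \<in> \<Q>" "R \<in> \<Q>"
    then obtain E F where EF: "finite E" "E \<subseteq> P" "Q = Z E" "finite F" "F \<subseteq> P" "R = Z F"
      by (auto simp: \<Q>_def)
    then have "zonotope (E \<union> F) v \<in> Q \<inter> R" by (auto simp: Z_def)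
    then show "Q \<inter> R \<noteq> {}" by blast
  next
    fix \<epsilon> :: real assume "\<epsilon> > 0"
    obtain E0 where E0: "finite E0" "E0 \<subseteq> P"
      "\<And>K. finite K \<Longrightarrow> K \<subseteq> P \<Longrightarrow> K \<inter> E0 = {} \<Longrightarrow> norm (sum v K) \<le> \<epsilon>/2"
      using has_sum_tail_le[OF assms half_gt_zero[OF \<open>\<epsilon> > 0\<close>]] by metis
    have near: "hausdorff_dist (zonotope E v) (zonotope E0 v) \<le> \<epsilon>/2"
      if E: "finite E" "E0 \<subseteq> E" "E \<subseteq> P" for E
    proof (rule hausdorff_dist_zonotope_superset_le[OF E(1,2)])
      fix K assume K: "K \<subseteq> E - E0"
      then show "norm (sum v K) \<le> \<epsilon>/2"
        using E by (intro E0(3)) (auto intro: finite_subset)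
    qed
    have "hausdorff_dist (zonotope E v) (zonotope F v) \<le> \<epsilon>/2 + \<epsilon>/2"
      if "finite E" "E0 \<subseteq> E" "E \<subseteq> P" "finite F" "E0 \<subseteq> F" "F \<subseteq> P" for E F
      using near[OF that(1-3)] near[OF that(4-6)]
      by (intro hausdorff_dist_triangle2[where B = "zonotope E0 v"] zonotope_in_ck)
        (simp_all add: hausdorff_dist_commute)
    then have "\<forall>S\<in>Z E0. \<forall>T\<in>Z E0. hausdorff_dist S T \<le> \<epsilon>"
      by (auto simp: Z_def)
    with E0 show "\<exists>Q\<in>\<Q>. \<forall>S\<in>Q. \<forall>T\<in>Q. hausdorff_dist S T \<le> \<epsilon>"
      by (auto simp: \<Q>_def)
  qed blast
  have "((\<lambda>E. hausdorff_dist S (zonotope E v)) \<longlongrightarrow> 0) (finite_subsets_at_top P)"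
  proof (rule tendstoI)
    fix \<epsilon> :: real assume "\<epsilon> > 0"
    then obtain E0 where E0: "finite E0" "E0 \<subseteq> P" "\<forall>T\<in>Z E0. hausdorff_dist S T \<le> \<epsilon>/2"
      using S(2)[of "\<epsilon>/2"] by (auto simp: \<Q>_def)
    have "dist (hausdorff_dist S (zonotope E v)) 0 < \<epsilon>" if "finite E" "E0 \<subseteq> E" "E \<subseteq> P" for E
    proof -
      have "zonotope E v \<in> Z E0" using that by (auto simp: Z_def)
      then have "hausdorff_dist S (zonotope E v) \<le> \<epsilon>/2" using E0(3) by blast
      moreover have "0 \<le> hausdorff_dist S (zonotope E v)"
        by (intro hausdorff_dist_nonneg S zonotope_in_ck)
      ultimately show ?thesis using \<open>\<epsilon> > 0\<close> by simp
    qed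
    with E0(1,2) show "\<forall>\<^sub>F E in finite_subsets_at_top P. dist (hausdorff_dist S (zonotope E v)) 0 < \<epsilon>"
      unfolding eventually_finite_subsets_at_top by blast
  qed
  with S(1) that show thesis by blast
qed

text \<open>Partial sums are the reflection vectors of the finite zonotopes and \<open>s\<close> is
  that of their limit, so \<open>centered_dist_le\<close> bounds the error of a partial sum by twice
  a Hausdorff distance.\<close>

lemma has_sum_if_zonotope_converges:
  fixes v :: "'i \<Rightarrow> 'a::banach"
  assumes S: "S \<in> ck"
    and lim: "((\<lambda>E. hausdorff_dist S (zonotope E v)) \<longlongrightarrow> 0) (finite_subsets_at_top P)"
  obtains s where "centered S s" "(v has_sum s) P"
proof -
  obtain s where s: "centered S s"
  proof (rule centered_limit[OF S])
    fix \<epsilon> :: real assume "\<epsilon> > 0"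
    then have "\<forall>\<^sub>F E in finite_subsets_at_top P. dist (hausdorff_dist S (zonotope E v)) 0 < \<epsilon>"
      by (rule tendstoD[OF lim])
    then obtain E where E: "finite E" "dist (hausdorff_dist S (zonotope E v)) 0 < \<epsilon>"
      unfolding eventually_finite_subsets_at_top by blast
    then have "hausdorff_dist S (zonotope E v) \<le> \<epsilon>" by simp
    with centered_zonotope[OF E(1)] zonotope_in_ck
    show "\<exists>T\<in>ck. \<exists>s. centered T s \<and> hausdorff_dist S T \<le> \<epsilon>" by blast
  qed
  have "((\<lambda>E. sum v E - s) \<longlongrightarrow> 0) (finite_subsets_at_top P)"
  proof (rule Lim_null_comparison)
    show "\<forall>\<^sub>F E in finite_subsets_at_top P. norm (sum v E - s) \<le> 2 * hausdorff_dist S (zonotope E v)"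
      using centered_dist_le[OF S zonotope_in_ck s centered_zonotope]
      by (intro eventually_finite_subsets_at_top_weakI) (simp add: norm_minus_commute)
    show "((\<lambda>E. 2 * hausdorff_dist S (zonotope E v)) \<longlongrightarrow> 0) (finite_subsets_at_top P)"
      using tendsto_mult_right_zero[OF lim] .
  qed
  then have "(v has_sum s) P"
    unfolding has_sum_def by (rule LIM_zero_cancel)
  with s that show thesis by blast
qed

section \<open>Measure and tags under refinement\<close>

text \<open>The missing weight \<open>1 - sum a I\<close> is put on the point 0, under the
  additional index \<open>None\<close>.\<close>

lemma convex_subconvex_sum_mem:
  assumes "convex S" "0 \<in> S" "finite I" and a: "\<And>i. i \<in> I \<Longrightarrow> 0 \<le> a i" "sum a I \<le> 1"
    and x: "\<And>i. i \<in> I \<Longrightarrow> x i \<in> S"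
  shows "(\<Sum>i\<in>I. a i *\<^sub>R x i) \<in> S"
proof -
  define b where "b j = (case j of None \<Rightarrow> 1 - sum a I | Some i \<Rightarrow> a i)" for j
  define y where "y j = (case j of None \<Rightarrow> 0 | Some i \<Rightarrow> x i)" for j
  have "(\<Sum>j\<in>insert None (Some ` I). b j *\<^sub>R y j) \<in> S"
    using assms by (intro convex_sum) (auto simp: b_def y_def sum.reindex)
  then show ?thesis
    using \<open>finite I\<close> by (simp add: sum.reindex b_def y_def)
qed

lemma countable_measurable_partitionD:
  assumes "countable_measurable_partition P"
  shows "countable P" "\<Union>P = {0..1}" "disjoint P" "{} \<notin> P"
    and "\<And>A. A \<in> P \<Longrightarrow> A \<in> lmeasurable" "\<And>A. A \<in> P \<Longrightarrow> A \<subseteq> {0..1}"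
proof -
  show "countable P" "\<Union>P = {0..1}" "disjoint P" "{} \<notin> P"
    using assms by (auto simp: countable_measurable_partition_def partition_on_def)
  fix A assume A: "A \<in> P"
  then show "A \<subseteq> {0..1}" using \<open>\<Union>P = {0..1}\<close> by blast
  moreover have "A \<in> sets lebesgue"
    using A assms by (auto simp: countable_measurable_partition_def)
  moreover have "{0..1::real} \<in> lmeasurable"
    using lmeasurable_cbox[of "0::real" 1] by simp
  ultimately show "A \<in> lmeasurable"
    by (metis fmeasurableI2)
qed

lemma common_refinement_measurable:
  assumes P: "countable_measurable_partition P" and Q: "countable_measurable_partition Q"
  obtains R where "countable_measurable_partition R" "refines {0..1} R P" "refines {0..1} R Q"
proof
  have p: "\<And>S. S \<in> {P, Q} \<Longrightarrow> partition_on {0..1} S"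
    using P Q by (auto simp: countable_measurable_partition_def)
  let ?R = "common_refinement {P, Q}"
  have sub: "?R \<subseteq> (\<lambda>(A, B). A \<inter> B) ` (P \<times> Q)"
    by (fastforce simp: common_refinement)
  have "countable ?R"
    using sub countable_measurable_partitionD(1)[OF P] countable_measurable_partitionD(1)[OF Q]
    by (meson countable_SIGMA countable_image countable_subset)
  moreover have "?R \<subseteq> sets lebesgue"
    using sub P Q unfolding countable_measurable_partition_def by fastforce
  ultimately show "countable_measurable_partition ?R"
    using partition_on_common_refinement[of "{P, Q}", OF p] by (simp add: countable_measurable_partition_def)
  show "refines {0..1} ?R P" "refines {0..1} ?R Q"
    using refines_common_refinement[of "{P, Q}", OF p] by auto
qed

text \<open>The upper estimate is additivity over disjoint cells inside \<open>A\<close>; the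
  approximation is continuity from below along an enumeration of the fine cells in \<open>A\<close>.
  Approximation is the useful form because only finite families \<open>E\<close> enter a
  zonotope.\<close>

lemma refined_cell_measure:
  assumes P0: "countable_measurable_partition P0" and P: "countable_measurable_partition P"
    and a: "\<And>C. C \<in> P \<Longrightarrow> a C \<in> P0" "\<And>C. C \<in> P \<Longrightarrow> C \<subseteq> a C"
    and A: "A \<in> P0"
  shows refined_cell_measure_le:
      "\<And>E. finite E \<Longrightarrow> E \<subseteq> P \<Longrightarrow> (\<Sum>C\<in>{C\<in>E. a C = A}. measure lebesgue C) \<le> measure lebesgue A"
    and refined_cell_measure_approx:
      "\<And>\<eta>. \<eta> > 0 \<Longrightarrow> \<exists>E0. finite E0 \<and> E0 \<subseteq> P \<and> (\<forall>E. finite E \<and> E0 \<subseteq> E \<and> E \<subseteq> P \<longrightarrow>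
        measure lebesgue A - (\<Sum>C\<in>{C\<in>E. a C = A}. measure lebesgue C) \<le> \<eta>)"
proof -
  have msum: "measure lebesgue (\<Union>K) = (\<Sum>C\<in>K. measure lebesgue C)" if "finite K" "K \<subseteq> P" for K
    using that countable_measurable_partitionD(3,5)[OF P]
    by (intro measure_Union') (auto simp: disjoint_def pairwise_def disjnt_def)
  show "(\<Sum>C\<in>{C\<in>E. a C = A}. measure lebesgue C) \<le> measure lebesgue A"
    if "finite E" "E \<subseteq> P" for E
  proof -
    have "(\<Sum>C\<in>{C\<in>E. a C = A}. measure lebesgue C) = measure lebesgue (\<Union>{C\<in>E. a C = A})"
      using that by (intro msum[symmetric]) auto
    also have "\<dots> \<le> measure lebesgue A"
    proof (rule measure_mono_fmeasurable)
      show "\<Union>{C\<in>E. a C = A} \<subseteq> A" using a(2) that by blast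
      show "\<Union>{C\<in>E. a C = A} \<in> sets lebesgue"
        using that countable_measurable_partitionD(5)[OF P]
        by (intro sets.finite_Union) auto
      show "A \<in> lmeasurable" by (rule countable_measurable_partitionD(5)[OF P0 A])
    qed
    finally show ?thesis .
  qed
  define Q where "Q = {C\<in>P. a C = A}"
  have UQ: "\<Union>Q = A"
  proof
    show "\<Union>Q \<subseteq> A" using a(2) by (auto simp: Q_def)
    show "A \<subseteq> \<Union>Q"
    proof
      fix x assume x: "x \<in> A"
      then have "x \<in> {0..1}" using countable_measurable_partitionD(6)[OF P0 A] by blast
      then obtain C where C: "C \<in> P" "x \<in> C"
        using countable_measurable_partitionD(2)[OF P] by blast
      \<comment> \<open>The point \<open>x\<close> lies in both \<open>a C\<close> and
        \<open>A\<close>, and distinct cells of \<open>P0\<close> are disjoint.\<close>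
      then have "a C = A"
        using a[OF C(1)] A x countable_measurable_partitionD(3)[OF P0]
        by (auto simp: disjoint_def)
      with C show "x \<in> \<Union>Q" by (auto simp: Q_def)
    qed
  qed
  have "Q \<noteq> {}"
    using UQ A countable_measurable_partitionD(4)[OF P0] by auto
  moreover have "countable Q"
    using countable_measurable_partitionD(1)[OF P] by (auto simp: Q_def)
  ultimately have ran: "range (from_nat_into Q) = Q"
    by (rule range_from_nat_into)
  \<comment> \<open>The enumeration repeats cells when \<open>Q\<close> is finite; taking unions
    over image sets makes this harmless.\<close>
  define D where "D n = \<Union>(from_nat_into Q ` {..n})" for n
  have fQ: "from_nat_into Q n \<in> P" "a (from_nat_into Q n) = A" for n
    using ran by (auto simp: Q_def)
  have "(\<Union>n. D n) = \<Union>(range (from_nat_into Q))" by (auto simp: D_def)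
  then have UD: "(\<Union>n. D n) = A" by (simp only: ran UQ)
  have "(\<lambda>n. measure lebesgue (D n)) \<longlonglongrightarrow> measure lebesgue (\<Union>n. D n)"
  proof (rule Lim_measure_incseq)
    show "range D \<subseteq> sets lebesgue"
      using fQ(1) countable_measurable_partitionD(5)[OF P] by (auto simp: D_def)
    show "incseq D" by (fastforce simp: D_def incseq_def)
    show "emeasure lebesgue (\<Union>n. D n) \<noteq> \<infinity>"
      unfolding UD using countable_measurable_partitionD(5)[OF P0 A] by (auto simp: fmeasurable_def)
  qed
  then have lim: "(\<lambda>n. measure lebesgue (D n)) \<longlonglongrightarrow> measure lebesgue A"
    by (simp only: UD)
  show "\<exists>E0. finite E0 \<and> E0 \<subseteq> P \<and> (\<forall>E. finite E \<and> E0 \<subseteq> E \<and> E \<subseteq> P \<longrightarrow>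
        measure lebesgue A - (\<Sum>C\<in>{C\<in>E. a C = A}. measure lebesgue C) \<le> \<eta>)" if "\<eta> > 0" for \<eta>
  proof -
    obtain n where n: "dist (measure lebesgue (D n)) (measure lebesgue A) < \<eta>"
      using metric_LIMSEQ_D[OF lim \<open>\<eta> > 0\<close>] by blast
    define E0 where "E0 = from_nat_into Q ` {..n}"
    have "measure lebesgue A - (\<Sum>C\<in>{C\<in>E. a C = A}. measure lebesgue C) \<le> \<eta>"
      if "finite E" "E0 \<subseteq> E" "E \<subseteq> P" for E
    proof -
      have "measure lebesgue (D n) = (\<Sum>C\<in>E0. measure lebesgue C)"
        unfolding D_def E0_def[symmetric] using fQ(1) by (intro msum) (auto simp: E0_def)
      also have "\<dots> \<le> (\<Sum>C\<in>{C\<in>E. a C = A}. measure lebesgue C)"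
        using that fQ by (intro sum_mono2) (auto simp: E0_def)
      finally show ?thesis using n by (simp add: dist_real_def)
    qed
    moreover have "finite E0" "E0 \<subseteq> P" using fQ(1) by (auto simp: E0_def)
    ultimately show ?thesis by blast
  qed
qed

text \<open>Switching the tags on finitely many cells changes the sum by exactly the finite sum
  considered here.\<close>

lemma Birkhoff_retag_le:
  fixes g :: "real \<Rightarrow> 'a::real_normed_vector"
  assumes close: "\<And>t. (\<And>A. A \<in> P \<Longrightarrow> t A \<in> A) \<Longrightarrow>
      \<exists>s. ((\<lambda>A. measure lebesgue A *\<^sub>R g (t A)) has_sum s) P \<and> norm (\<phi> - s) < \<epsilon>"
    and r: "\<And>A. A \<in> P \<Longrightarrow> r A \<in> A" and t: "\<And>A. A \<in> P \<Longrightarrow> t A \<in> A"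
    and F: "finite F" "F \<subseteq> P"
  shows "norm (\<Sum>A\<in>F. measure lebesgue A *\<^sub>R (g (r A) - g (t A))) \<le> 2 * \<epsilon>"
proof -
  define q where "q A = (if A \<in> F then r A else t A)" for A
  have "\<And>A. A \<in> P \<Longrightarrow> q A \<in> A" using r t by (simp add: q_def)
  then obtain x where x: "((\<lambda>A. measure lebesgue A *\<^sub>R g (q A)) has_sum x) P" "norm (\<phi> - x) < \<epsilon>"
    using close by blast
  obtain y where y: "((\<lambda>A. measure lebesgue A *\<^sub>R g (t A)) has_sum y) P" "norm (\<phi> - y) < \<epsilon>"
    using close t by blast
  have "((\<lambda>A. measure lebesgue A *\<^sub>R g (q A) - measure lebesgue A *\<^sub>R g (t A)) has_sum (x - y)) P"
    using has_sum_add[OF x(1), of "\<lambda>A. - (measure lebesgue A *\<^sub>R g (t A))" "- y"] y(1)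
    by (simp add: has_sum_uminus)
  moreover have "((\<lambda>A. measure lebesgue A *\<^sub>R g (q A) - measure lebesgue A *\<^sub>R g (t A)) has_sum
      (\<Sum>A\<in>F. measure lebesgue A *\<^sub>R (g (r A) - g (t A)))) P"
    using F by (intro has_sum_finite_neutralI) (auto simp: q_def algebra_simps)
  ultimately have "(\<Sum>A\<in>F. measure lebesgue A *\<^sub>R (g (r A) - g (t A))) = x - y"
    using has_sum_unique by blast
  also have "norm \<dots> = norm ((\<phi> - y) - (\<phi> - x))" by simp
  also have "\<dots> \<le> 2 * \<epsilon>"
    using norm_triangle_ineq4[of "\<phi> - y" "\<phi> - x"] x(2) y(2) by linarith
  finally show ?thesis .
qed

text \<open>A fine tag \<open>r C\<close> is also an admissible tag of the coarse cell
  \<open>A\<close> around \<open>C\<close>. The fine terms inside \<open>A\<close> therefore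
  combine, with weights \<open>c C * measure lebesgue C / measure lebesgue A\<close> of total at
  most 1, differences caused by retagging \<open>A\<close>. Passing to convex hulls reduces the
  estimate to retagging coarse cells.\<close>

lemma Birkhoff_refined_retag_le:
  fixes g :: "real \<Rightarrow> 'a::real_normed_vector"
  assumes P0: "countable_measurable_partition P0" and P: "countable_measurable_partition P"
    and a: "\<And>C. C \<in> P \<Longrightarrow> a C \<in> P0" "\<And>C. C \<in> P \<Longrightarrow> C \<subseteq> a C"
    and close: "\<And>t. (\<And>A. A \<in> P0 \<Longrightarrow> t A \<in> A) \<Longrightarrow>
      \<exists>s. ((\<lambda>A. measure lebesgue A *\<^sub>R g (t A)) has_sum s) P0 \<and> norm (\<phi> - s) < \<epsilon>"
    and r: "\<And>C. C \<in> P \<Longrightarrow> r C \<in> C" and t: "\<And>A. A \<in> P0 \<Longrightarrow> t A \<in> A"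
    and E: "finite E" "E \<subseteq> P" and c: "\<And>C. C \<in> E \<Longrightarrow> c C \<in> {0..1}"
  shows "norm (\<Sum>C\<in>E. c C *\<^sub>R (measure lebesgue C *\<^sub>R g (r C) - measure lebesgue C *\<^sub>R g (t (a C)))) \<le> 2 * \<epsilon>"
proof -
  define F where "F = a ` E"
  have F: "finite F" "F \<subseteq> P0" using E a(1) by (auto simp: F_def)
  define x where "x A = (\<Sum>C\<in>{C\<in>E. a C = A}. (c C * measure lebesgue C) *\<^sub>R (g (r C) - g (t A)))" for A
  define V where "V A = (\<lambda>s. measure lebesgue A *\<^sub>R (g s - g (t A))) ` A" for A
  have "(\<Sum>C\<in>E. c C *\<^sub>R (measure lebesgue C *\<^sub>R g (r C) - measure lebesgue C *\<^sub>R g (t (a C))))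
      = (\<Sum>A\<in>F. \<Sum>C\<in>{C\<in>E. a C = A}. c C *\<^sub>R (measure lebesgue C *\<^sub>R g (r C) - measure lebesgue C *\<^sub>R g (t (a C))))"
    using E F by (intro sum.group[symmetric]) (auto simp: F_def)
  also have "\<dots> = (\<Sum>A\<in>F. x A)"
    by (intro sum.cong refl) (auto simp: x_def algebra_simps intro!: sum.cong)
  also have "norm \<dots> \<le> 2 * \<epsilon>"
  proof (rule norm_sum_convex_hull_le[OF F(1), where V = V])
    fix y assume "\<And>A. A \<in> F \<Longrightarrow> y A \<in> V A"
    then have "\<forall>A\<in>F. \<exists>s. s \<in> A \<and> y A = measure lebesgue A *\<^sub>R (g s - g (t A))"
      by (auto simp: V_def)
    then obtain s where s: "\<forall>A\<in>F. s A \<in> A \<and> y A = measure lebesgue A *\<^sub>R (g (s A) - g (t A))"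
      by metis
    define q where "q A = (if A \<in> F then s A else t A)" for A
    have q: "q A \<in> A" if "A \<in> P0" for A using s t[OF that] by (simp add: q_def)
    have eq: "(\<Sum>A\<in>F. y A) = (\<Sum>A\<in>F. measure lebesgue A *\<^sub>R (g (q A) - g (t A)))"
      using s by (intro sum.cong) (auto simp: q_def)
    show "norm (\<Sum>A\<in>F. y A) \<le> 2 * \<epsilon>"
      unfolding eq by (rule Birkhoff_retag_le[OF close q t F])
  next
    fix A assume "A \<in> F"
    then have A: "A \<in> P0" using F by blast
    \<comment> \<open>Keeping the old tag gives 0; it takes up the weight lost through
      \<open>c\<close> and through the part of \<open>A\<close> that \<open>E\<close> does not
      cover.\<close>
    have "0 \<in> V A"
      unfolding V_def by (rule image_eqI[OF _ t[OF A]]) simp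
    then have 0: "0 \<in> convex hull (V A)" by (rule hull_inc)
    have le: "(\<Sum>C\<in>{C\<in>E. a C = A}. measure lebesgue C) \<le> measure lebesgue A"
      by (rule refined_cell_measure_le[OF P0 P a A E])
    show "x A \<in> convex hull (V A)"
    \<comment> \<open>The weights are quotients by the measure of \<open>A\<close>; in a null cell
      all fine cells are null as well and the contribution vanishes.\<close>
    proof (cases "measure lebesgue A = 0")
      case True
      then have "(\<Sum>C\<in>{C\<in>E. a C = A}. measure lebesgue C) = 0"
        using le by (intro antisym sum_nonneg) auto
      then have "\<forall>C\<in>{C\<in>E. a C = A}. measure lebesgue C = 0"
        using E(1) by (subst (asm) sum_nonneg_eq_0_iff) auto
      then have "x A = 0" by (auto simp: x_def intro!: sum.neutral)
      with 0 show ?thesis by simp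
    next
      case False
      then have pos: "measure lebesgue A > 0" using measure_nonneg[of lebesgue A] by linarith
      have "x A = (\<Sum>C\<in>{C\<in>E. a C = A}. (c C * measure lebesgue C / measure lebesgue A) *\<^sub>R
          (measure lebesgue A *\<^sub>R (g (r C) - g (t A))))"
        using pos by (simp add: x_def)
      also have "\<dots> \<in> convex hull (V A)"
      proof (rule convex_subconvex_sum_mem[OF convex_convex_hull 0])
        show "finite {C\<in>E. a C = A}" using E(1) by simp
        show "0 \<le> c C * measure lebesgue C / measure lebesgue A" if "C \<in> {C\<in>E. a C = A}" for C
          using c[of C] that by simp
        have "(\<Sum>C\<in>{C\<in>E. a C = A}. c C * measure lebesgue C) \<le> (\<Sum>C\<in>{C\<in>E. a C = A}. measure lebesgue C)"
          using c by (intro sum_mono) (auto intro!: mult_left_le_one_le)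
        with le pos show "(\<Sum>C\<in>{C\<in>E. a C = A}. c C * measure lebesgue C / measure lebesgue A) \<le> 1"
          by (simp flip: sum_divide_distrib)
        fix C assume C: "C \<in> {C\<in>E. a C = A}"
        then have "r C \<in> A" using r[of C] a(2)[of C] E(2) by auto
        then have "measure lebesgue A *\<^sub>R (g (r C) - g (t A)) \<in> V A" by (auto simp: V_def)
        then show "measure lebesgue A *\<^sub>R (g (r C) - g (t A)) \<in> convex hull (V A)" by (rule hull_inc)
      qed
      finally show ?thesis .
    qed
  qed
  finally show ?thesis .
qed

section \<open>Comparison of refined sums with a coarse one\<close>

text \<open>Here \<open>l i\<close> is the measure of a coarse cell and \<open>m i\<close> the
  portion of it that has been filled. On \<open>F0\<close> the defect \<open>l i - m i\<close> is
  small enough to beat the norms of the \<open>w i\<close>. Outside \<open>F0\<close> it may be a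
  large share of \<open>l i\<close>, but it is a fraction in \<open>{0..1}\<close> of it, so the
  tail bound on sub-sums carries over.\<close>

lemma hausdorff_dist_zonotope_defect_le:
  fixes w :: "'i \<Rightarrow> 'a::real_normed_vector"
  assumes F: "finite F" "F0 \<subseteq> F" and ml: "\<And>i. i \<in> F \<Longrightarrow> 0 \<le> m i" "\<And>i. i \<in> F \<Longrightarrow> m i \<le> l i"
    and near: "\<And>i. i \<in> F0 \<Longrightarrow> (l i - m i) * (1 + (\<Sum>i\<in>F0. norm (w i))) \<le> \<eta>"
    and tail: "\<And>K. K \<subseteq> F - F0 \<Longrightarrow> norm (\<Sum>i\<in>K. l i *\<^sub>R w i) \<le> \<eta>" and "0 < \<eta>"
  shows "hausdorff_dist (zonotope F (\<lambda>i. l i *\<^sub>R w i)) (zonotope F (\<lambda>i. m i *\<^sub>R w i)) \<le> 2 * \<eta>"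
proof (rule hausdorff_dist_zonotope_le[OF F(1)])
  fix K assume K: "K \<subseteq> F"
  \<comment> \<open>The summand 1 makes \<open>M\<close> positive even if all \<open>w i\<close>
    vanish or \<open>F0\<close> is empty.\<close>
  define M where "M = 1 + (\<Sum>i\<in>F0. norm (w i))"
  have M: "M > 0" unfolding M_def by (simp add: add_pos_nonneg sum_nonneg)
  have finK: "finite K" "finite F0" using K F finite_subset by auto
  have "norm (\<Sum>i\<in>K \<inter> F0. (l i - m i) *\<^sub>R w i) \<le> (\<Sum>i\<in>K \<inter> F0. norm ((l i - m i) *\<^sub>R w i))"
    by (rule norm_sum)
  also have "\<dots> \<le> (\<Sum>i\<in>K \<inter> F0. \<eta> / M * norm (w i))"
  proof (rule sum_mono)
    fix i assume i: "i \<in> K \<inter> F0"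
    have "0 \<le> l i - m i" "l i - m i \<le> \<eta> / M"
      using ml(2)[of i] near[of i] i K M by (auto simp: M_def[symmetric] pos_le_divide_eq)
    then show "norm ((l i - m i) *\<^sub>R w i) \<le> \<eta> / M * norm (w i)"
      by (metis abs_of_nonneg mult_right_mono norm_ge_zero norm_scaleR)
  qed
  also have "\<dots> \<le> (\<Sum>i\<in>F0. \<eta> / M * norm (w i))"
    using finK M \<open>0 < \<eta>\<close> by (intro sum_mono2) auto
  also have "\<dots> = \<eta> / M * (\<Sum>i\<in>F0. norm (w i))"
    by (simp add: sum_distrib_left)
  also have "\<dots> \<le> \<eta> / M * M"
    using M \<open>0 < \<eta>\<close> by (intro mult_left_mono) (auto simp: M_def)
  finally have 1: "norm (\<Sum>i\<in>K \<inter> F0. (l i - m i) *\<^sub>R w i) \<le> \<eta>" using M by simp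
  \<comment> \<open>If \<open>l i = 0\<close> then \<open>m i = 0\<close> too, so the quotient with
    value 0 is correct there.\<close>
  have "(\<Sum>i\<in>K - F0. (l i - m i) *\<^sub>R w i) = (\<Sum>i\<in>K - F0. ((l i - m i) / l i) *\<^sub>R (l i *\<^sub>R w i))"
  proof (rule sum.cong[OF refl])
    fix i assume "i \<in> K - F0"
    then have "0 \<le> m i" "m i \<le> l i" using ml K by auto
    then show "(l i - m i) *\<^sub>R w i = ((l i - m i) / l i) *\<^sub>R (l i *\<^sub>R w i)" by (cases "l i = 0") auto
  qed
  also have "norm \<dots> \<le> \<eta>"
  proof (rule norm_weighted_sum_le)
    show "finite (K - F0)" using finK by simp
    show "norm (\<Sum>i\<in>J. l i *\<^sub>R w i) \<le> \<eta>" if "J \<subseteq> K - F0" for J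
      using that K by (intro tail) auto
    fix i assume "i \<in> K - F0"
    then have "0 \<le> m i" "m i \<le> l i" using ml K by auto
    then show "(l i - m i) / l i \<in> {0..1}" by (auto simp: divide_simps)
  qed
  finally have 2: "norm (\<Sum>i\<in>K - F0. (l i - m i) *\<^sub>R w i) \<le> \<eta>" .
  have "(\<Sum>i\<in>K. l i *\<^sub>R w i - m i *\<^sub>R w i) = (\<Sum>i\<in>K \<inter> F0. (l i - m i) *\<^sub>R w i) + (\<Sum>i\<in>K - F0. (l i - m i) *\<^sub>R w i)"
    using sum.Int_Diff[OF finK(1), of "\<lambda>i. (l i - m i) *\<^sub>R w i" F0] by (simp add: scaleR_left_diff_distrib)
  then show "norm (\<Sum>i\<in>K. l i *\<^sub>R w i - m i *\<^sub>R w i) \<le> 2 * \<eta>"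
    using norm_triangle_mono[OF 1 2] by simp
qed

text \<open>The chain of comparison runs from \<open>S\<close> to a finite fine zonotope, then to
  the same cells with coarse tags, grouped into coarse cells filled only partly, then to completely
  filled cells, and finally to \<open>T\<close>. Only the change of tags costs
  \<open>2 * \<epsilon>\<close>; the other errors can be made arbitrarily small.\<close>

lemma Birkhoff_zonotope_limits_close:
  fixes g :: "real \<Rightarrow> 'a::banach"
  assumes P0: "countable_measurable_partition P0" and P: "countable_measurable_partition P"
    and ref: "refines {0..1} P P0"
    and close: "\<And>t. (\<And>A. A \<in> P0 \<Longrightarrow> t A \<in> A) \<Longrightarrow>
      \<exists>s. ((\<lambda>A. measure lebesgue A *\<^sub>R g (t A)) has_sum s) P0 \<and> norm (\<phi> - s) < \<epsilon>"
    and r: "\<And>C. C \<in> P \<Longrightarrow> r C \<in> C" and t: "\<And>A. A \<in> P0 \<Longrightarrow> t A \<in> A"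
    and S: "S \<in> ck" "((\<lambda>E. hausdorff_dist S (zonotope E (\<lambda>C. measure lebesgue C *\<^sub>R g (r C)))) \<longlongrightarrow> 0)
      (finite_subsets_at_top P)"
    and T: "T \<in> ck" "((\<lambda>E. hausdorff_dist T (zonotope E (\<lambda>A. measure lebesgue A *\<^sub>R g (t A)))) \<longlongrightarrow> 0)
      (finite_subsets_at_top P0)"
  shows "hausdorff_dist S T \<le> 2 * \<epsilon>"
proof (rule field_le_epsilon)
  fix e :: real assume "e > 0"
  \<comment> \<open>One \<open>\<eta>\<close> for each of the two limits and two for the defect of
    measure.\<close>
  define \<eta> where "\<eta> = e / 4"
  have \<eta>: "\<eta> > 0" using \<open>e > 0\<close> by (simp add: \<eta>_def)
  let ?l = "measure lebesgue"
  obtain a where a: "\<And>C. C \<in> P \<Longrightarrow> a C \<in> P0" "\<And>C. C \<in> P \<Longrightarrow> C \<subseteq> a C"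
    using ref unfolding refines_def by metis
  obtain s where s: "((\<lambda>A. ?l A *\<^sub>R g (t A)) has_sum s) P0"
    using close[of t] t by blast
  obtain F1 where F1: "finite F1" "F1 \<subseteq> P0"
    "\<And>K. finite K \<Longrightarrow> K \<subseteq> P0 \<Longrightarrow> K \<inter> F1 = {} \<Longrightarrow> norm (\<Sum>A\<in>K. ?l A *\<^sub>R g (t A)) \<le> \<eta>"
    using has_sum_tail_le[OF s \<eta>] by metis
  have "\<forall>\<^sub>F F in finite_subsets_at_top P0. dist (hausdorff_dist T (zonotope F (\<lambda>A. ?l A *\<^sub>R g (t A)))) 0 < \<eta>"
    by (rule tendstoD[OF T(2) \<eta>])
  then obtain F2 where F2: "finite F2" "F2 \<subseteq> P0" "\<And>F. finite F \<Longrightarrow> F2 \<subseteq> F \<Longrightarrow> F \<subseteq> P0 \<Longrightarrow>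
      dist (hausdorff_dist T (zonotope F (\<lambda>A. ?l A *\<^sub>R g (t A)))) 0 < \<eta>"
    unfolding eventually_finite_subsets_at_top by metis
  have "\<forall>\<^sub>F E in finite_subsets_at_top P. dist (hausdorff_dist S (zonotope E (\<lambda>C. ?l C *\<^sub>R g (r C)))) 0 < \<eta>"
    by (rule tendstoD[OF S(2) \<eta>])
  then obtain E1 where E1: "finite E1" "E1 \<subseteq> P" "\<And>E. finite E \<Longrightarrow> E1 \<subseteq> E \<Longrightarrow> E \<subseteq> P \<Longrightarrow>
      dist (hausdorff_dist S (zonotope E (\<lambda>C. ?l C *\<^sub>R g (r C)))) 0 < \<eta>"
    unfolding eventually_finite_subsets_at_top by metis
  \<comment> \<open>\<open>F1\<close> controls the tail of the sum of \<open>g\<close>,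
    \<open>F2\<close> the approximation of \<open>T\<close> by finite zonotopes.\<close>
  define F0 where "F0 = F1 \<union> F2"
  have F0: "finite F0" "F0 \<subseteq> P0" using F1 F2 by (auto simp: F0_def)
  define M where "M = 1 + (\<Sum>A\<in>F0. norm (g (t A)))"
  have M: "M > 0" unfolding M_def by (simp add: add_pos_nonneg sum_nonneg)
  \<comment> \<open>Each cell of \<open>F0\<close> is to be filled up to measure
    \<open>\<eta> / M\<close>, which matches the hypothesis on \<open>F0\<close> in
    \<open>hausdorff_dist_zonotope_defect_le\<close>.\<close>
  have "\<forall>A\<in>F0. \<exists>E0. finite E0 \<and> E0 \<subseteq> P \<and> (\<forall>E. finite E \<and> E0 \<subseteq> E \<and> E \<subseteq> P \<longrightarrow>
      ?l A - (\<Sum>C\<in>{C\<in>E. a C = A}. ?l C) \<le> \<eta> / M)"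
    using refined_cell_measure_approx[OF P0 P a] F0(2) \<eta> M by (meson divide_pos_pos subsetD)
  from bchoice[OF this] obtain D
    where D: "\<forall>A\<in>F0. finite (D A) \<and> D A \<subseteq> P \<and> (\<forall>E. finite E \<and> D A \<subseteq> E \<and> E \<subseteq> P \<longrightarrow>
      ?l A - (\<Sum>C\<in>{C\<in>E. a C = A}. ?l C) \<le> \<eta> / M)"
    by blast
  define E where "E = E1 \<union> (\<Union>A\<in>F0. D A)"
  have E: "finite E" "E \<subseteq> P" "E1 \<subseteq> E" "\<And>A. A \<in> F0 \<Longrightarrow> D A \<subseteq> E"
    using E1 D F0 by (auto simp: E_def)
  \<comment> \<open>Grouping requires the coarse cells of all of \<open>E\<close>, and some of these
    may lie outside \<open>F0\<close>; on them the defect is handled by the tail bound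
    alone.\<close>
  define F where "F = F0 \<union> a ` E"
  have F: "finite F" "F \<subseteq> P0" "F0 \<subseteq> F" "a ` E \<subseteq> F"
    using E F0 a(1) by (auto simp: F_def)
  define m where "m A = (\<Sum>C\<in>{C\<in>E. a C = A}. ?l C)" for A
  have 1: "hausdorff_dist S (zonotope E (\<lambda>C. ?l C *\<^sub>R g (r C))) \<le> \<eta>"
    using E1(3)[OF E(1,3,2)] by simp
  have 2: "hausdorff_dist (zonotope E (\<lambda>C. ?l C *\<^sub>R g (r C))) (zonotope E (\<lambda>C. ?l C *\<^sub>R g (t (a C)))) \<le> 2 * \<epsilon>"
    using E(1) Birkhoff_refined_retag_le[OF P0 P a close r t E(1,2)]
    by (rule hausdorff_dist_zonotope_le_weighted)
  have 3: "zonotope E (\<lambda>C. ?l C *\<^sub>R g (t (a C))) = zonotope F (\<lambda>A. m A *\<^sub>R g (t A))"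
    unfolding m_def by (rule zonotope_group[OF E(1) F(1,4)]) simp
  have 4: "hausdorff_dist (zonotope F (\<lambda>A. ?l A *\<^sub>R g (t A))) (zonotope F (\<lambda>A. m A *\<^sub>R g (t A))) \<le> 2 * \<eta>"
  proof (rule hausdorff_dist_zonotope_defect_le[OF F(1,3) _ _ _ _ \<eta>])
    fix A assume "A \<in> F"
    then have "A \<in> P0" using F(2) by blast
    from refined_cell_measure_le[OF P0 P a this E(1,2)] show "m A \<le> ?l A"
      by (simp add: m_def)
    show "0 \<le> m A" by (simp add: m_def sum_nonneg)
  next
    fix A assume "A \<in> F0"
    then have "?l A - m A \<le> \<eta> / M"
      unfolding m_def using D E by blast
    then show "(?l A - m A) * (1 + (\<Sum>A\<in>F0. norm (g (t A)))) \<le> \<eta>"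
      using M by (simp add: M_def[symmetric] pos_le_divide_eq)
  next
    fix K assume "K \<subseteq> F - F0"
    then show "norm (\<Sum>A\<in>K. ?l A *\<^sub>R g (t A)) \<le> \<eta>"
      using F(1,2) by (intro F1(3)) (auto simp: F0_def intro: finite_subset)
  qed
  have 5: "hausdorff_dist T (zonotope F (\<lambda>A. ?l A *\<^sub>R g (t A))) \<le> \<eta>"
    using F2(3)[OF F(1) _ F(2)] F(3) by (simp add: F0_def)
  have "hausdorff_dist T (zonotope F (\<lambda>A. m A *\<^sub>R g (t A))) \<le> \<eta> + 2 * \<eta>"
    using hausdorff_dist_triangle[OF T(1) zonotope_in_ck zonotope_in_ck] 4 5
    by (meson add_mono order_trans)
  moreover have "hausdorff_dist S (zonotope F (\<lambda>A. m A *\<^sub>R g (t A))) \<le> \<eta> + 2 * \<epsilon>"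
    using hausdorff_dist_triangle[OF S(1) zonotope_in_ck zonotope_in_ck] 1 2
    unfolding 3[symmetric] by (meson add_mono order_trans)
  ultimately have "hausdorff_dist S T \<le> (\<eta> + 2 * \<epsilon>) + (\<eta> + 2 * \<eta>)"
    by (intro hausdorff_dist_triangle2[OF S(1) zonotope_in_ck T(1)])
      (simp_all add: hausdorff_dist_commute)
  then show "hausdorff_dist S T \<le> 2 * \<epsilon> + e"
    by (simp add: \<eta>_def)
qed

section \<open>The two Birkhoff implications\<close>

lemma hausdorff_has_sum_iff_zonotope:
  fixes g :: "real \<Rightarrow> 'a::real_normed_vector"
  assumes G: "\<forall>t\<in>{0..1}. G t = convex hull {0, g t}"
    and P: "countable_measurable_partition P" and t: "\<And>A. A \<in> P \<Longrightarrow> t A \<in> A"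
  shows "hausdorff_has_sum (\<lambda>A. (\<lambda>x. measure lebesgue A *\<^sub>R x) ` G (t A)) S P \<longleftrightarrow>
    S \<in> ck \<and> ((\<lambda>E. hausdorff_dist S (zonotope E (\<lambda>A. measure lebesgue A *\<^sub>R g (t A)))) \<longlongrightarrow> 0)
      (finite_subsets_at_top P)"
proof -
  have "(\<lambda>x. measure lebesgue A *\<^sub>R x) ` G (t A) = closed_segment 0 (measure lebesgue A *\<^sub>R g (t A))"
    if "A \<in> P" for A
  proof -
    have "t A \<in> {0..1}" using t[OF that] countable_measurable_partitionD(6)[OF P that] by blast
    then have "G (t A) = convex hull {0, g (t A)}" using G by blast
    then show ?thesis by (simp only: scaleR_segment_image)
  qed
  then have eq: "(\<Sum>A\<in>E. (\<lambda>x. measure lebesgue A *\<^sub>R x) ` G (t A))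
      = zonotope E (\<lambda>A. measure lebesgue A *\<^sub>R g (t A))" if "E \<subseteq> P" for E
    using that unfolding zonotope_def by (intro sum.cong) auto
  have "\<forall>\<^sub>F E in finite_subsets_at_top P.
      hausdorff_dist S (\<Sum>A\<in>E. (\<lambda>x. measure lebesgue A *\<^sub>R x) ` G (t A))
      = hausdorff_dist S (zonotope E (\<lambda>A. measure lebesgue A *\<^sub>R g (t A)))"
    by (intro eventually_finite_subsets_at_top_weakI) (simp only: eq)
  from tendsto_cong[OF this] show ?thesis
    by (simp only: hausdorff_has_sum_def)
qed

lemma countable_measurable_partition_tags:
  assumes "countable_measurable_partition P"
  shows "\<exists>t. \<forall>A\<in>P. t A \<in> A"
  using countable_measurable_partitionD(4)[OF assms] by (intro bchoice) (metis all_not_in_conv)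

lemma countable_measurable_partition_refines_refl:
  "countable_measurable_partition P \<Longrightarrow> refines {0..1} P P"
  by (simp add: countable_measurable_partition_def refines_refl)

lemma Birkhoff_integrable_if_multi:
  fixes g :: "real \<Rightarrow> 'a::banach"
  assumes G: "\<forall>t\<in>{0..1}. G t = convex hull {0, g t}" and int: "Birkhoff_integrable_multi G"
  shows "Birkhoff_integrable g"
proof -
  obtain \<Phi> where \<Phi>: "\<Phi> \<in> ck" and part: "\<And>\<epsilon>. \<epsilon> > 0 \<Longrightarrow> \<exists>P\<^sub>0. countable_measurable_partition P\<^sub>0 \<and>
      (\<forall>P t. countable_measurable_partition P \<and> refines {0..1} P P\<^sub>0 \<and> (\<forall>A\<in>P. t A \<in> A) \<longrightarrow>
        (\<exists>S. hausdorff_has_sum (\<lambda>A. (\<lambda>x. measure lebesgue A *\<^sub>R x) ` G (t A)) S P \<and>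
          hausdorff_dist \<Phi> S < \<epsilon>))"
    using int unfolding Birkhoff_integrable_multi_def by blast
  \<comment> \<open>Every convergent Minkowski sum \<open>S\<close> is symmetric, and its reflection
    vector is the sum of the series for \<open>g\<close> with the same tags.\<close>
  have sums: "\<exists>P\<^sub>0. countable_measurable_partition P\<^sub>0 \<and>
      (\<forall>P t. countable_measurable_partition P \<and> refines {0..1} P P\<^sub>0 \<and> (\<forall>A\<in>P. t A \<in> A) \<longrightarrow>
        (\<exists>S s. S \<in> ck \<and> centered S s \<and> ((\<lambda>A. measure lebesgue A *\<^sub>R g (t A)) has_sum s) P \<and>
          hausdorff_dist \<Phi> S < \<epsilon>))" if "\<epsilon> > 0" for \<epsilon>
  proof -
    obtain P0 where P0: "countable_measurable_partition P0"
      "\<And>P t. countable_measurable_partition P \<Longrightarrow> refines {0..1} P P0 \<Longrightarrow> (\<forall>A\<in>P. t A \<in> A) \<Longrightarrow>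
        (\<exists>S. hausdorff_has_sum (\<lambda>A. (\<lambda>x. measure lebesgue A *\<^sub>R x) ` G (t A)) S P \<and>
          hausdorff_dist \<Phi> S < \<epsilon>)"
      using part[OF \<open>\<epsilon> > 0\<close>] by blast
    have "\<exists>S s. S \<in> ck \<and> centered S s \<and> ((\<lambda>A. measure lebesgue A *\<^sub>R g (t A)) has_sum s) P \<and>
          hausdorff_dist \<Phi> S < \<epsilon>"
      if P: "countable_measurable_partition P" "refines {0..1} P P0" and t: "\<forall>A\<in>P. t A \<in> A" for P t
    proof -
      obtain S where S: "hausdorff_has_sum (\<lambda>A. (\<lambda>x. measure lebesgue A *\<^sub>R x) ` G (t A)) S P"
        "hausdorff_dist \<Phi> S < \<epsilon>" using P0(2)[OF P t] by blast
      have S': "S \<in> ck" "((\<lambda>E. hausdorff_dist S (zonotope E (\<lambda>A. measure lebesgue A *\<^sub>R g (t A)))) \<longlongrightarrow> 0)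
          (finite_subsets_at_top P)"
        using hausdorff_has_sum_iff_zonotope[OF G P(1), of t S] t S(1) by blast+
      obtain s where "centered S s" "((\<lambda>A. measure lebesgue A *\<^sub>R g (t A)) has_sum s) P"
        using has_sum_if_zonotope_converges[OF S'] .
      with S(2) S'(1) show ?thesis by blast
    qed
    with P0(1) show ?thesis by blast
  qed
  obtain \<phi> where \<phi>: "centered \<Phi> \<phi>"
  proof (rule centered_limit[OF \<Phi>])
    fix \<epsilon> :: real assume "\<epsilon> > 0"
    obtain P0 where P0: "countable_measurable_partition P0"
      "\<And>P t. countable_measurable_partition P \<Longrightarrow> refines {0..1} P P0 \<Longrightarrow> (\<forall>A\<in>P. t A \<in> A) \<Longrightarrow>
        (\<exists>S s. S \<in> ck \<and> centered S s \<and> ((\<lambda>A. measure lebesgue A *\<^sub>R g (t A)) has_sum s) P \<and>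
          hausdorff_dist \<Phi> S < \<epsilon>)"
      using sums[OF \<open>\<epsilon> > 0\<close>] by blast
    obtain t where "\<And>A. A \<in> P0 \<Longrightarrow> t A \<in> A"
      using countable_measurable_partition_tags[OF P0(1)] by blast
    then have "\<forall>A\<in>P0. t A \<in> A" by blast
    from P0(2)[OF P0(1) countable_measurable_partition_refines_refl[OF P0(1)] this]
    show "\<exists>S\<in>ck. \<exists>s. centered S s \<and> hausdorff_dist \<Phi> S \<le> \<epsilon>"
      using less_imp_le by blast
  qed
  show ?thesis
    unfolding Birkhoff_integrable_def
  proof (intro exI[of _ \<phi>] allI impI)
    fix \<epsilon> :: real assume "\<epsilon> > 0"
    then have "\<epsilon>/2 > 0" by simp
    obtain P0 where P0: "countable_measurable_partition P0"
      "\<And>P t. countable_measurable_partition P \<Longrightarrow> refines {0..1} P P0 \<Longrightarrow> (\<forall>A\<in>P. t A \<in> A) \<Longrightarrow>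
        (\<exists>S s. S \<in> ck \<and> centered S s \<and> ((\<lambda>A. measure lebesgue A *\<^sub>R g (t A)) has_sum s) P \<and>
          hausdorff_dist \<Phi> S < \<epsilon>/2)"
      using sums[OF \<open>\<epsilon>/2 > 0\<close>] by blast
    have "\<exists>s. ((\<lambda>A. measure lebesgue A *\<^sub>R g (t A)) has_sum s) P \<and> norm (\<phi> - s) < \<epsilon>"
      if P: "countable_measurable_partition P" "refines {0..1} P P0" and t: "\<forall>A\<in>P. t A \<in> A" for P t
    proof -
      obtain S s where S: "S \<in> ck" "centered S s" "hausdorff_dist \<Phi> S < \<epsilon>/2"
        and s: "((\<lambda>A. measure lebesgue A *\<^sub>R g (t A)) has_sum s) P"
        using P0(2)[OF P t] by blast
      have "norm (\<phi> - s) < \<epsilon>"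
        using centered_dist_le[OF \<Phi> S(1) \<phi> S(2)] S(3) by linarith
      with s show ?thesis by blast
    qed
    with P0(1) show "\<exists>P\<^sub>0. countable_measurable_partition P\<^sub>0 \<and>
        (\<forall>P t. countable_measurable_partition P \<and> refines {0..1} P P\<^sub>0 \<and> (\<forall>A\<in>P. t A \<in> A) \<longrightarrow>
           (\<exists>s. ((\<lambda>A. measure lebesgue A *\<^sub>R g (t A)) has_sum s) P \<and> norm (\<phi> - s) < \<epsilon>))"
      by blast
  qed
qed

lemma Birkhoff_integrable_multi_if:
  fixes g :: "real \<Rightarrow> 'a::banach"
  assumes G: "\<forall>t\<in>{0..1}. G t = convex hull {0, g t}" and int: "Birkhoff_integrable g"
  shows "Birkhoff_integrable_multi G"
proof -
  define v where "v t = (\<lambda>A. measure lebesgue A *\<^sub>R g (t A))" for t :: "real set \<Rightarrow> real"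
  define tagged where "tagged P0 P t \<longleftrightarrow> countable_measurable_partition P \<and> refines {0..1} P P0 \<and> (\<forall>A\<in>P. t A \<in> A)"
    for P0 P and t :: "real set \<Rightarrow> real"
  obtain \<phi> where part: "\<And>\<epsilon>. \<epsilon> > 0 \<Longrightarrow> \<exists>P\<^sub>0. countable_measurable_partition P\<^sub>0 \<and>
      (\<forall>P t. tagged P\<^sub>0 P t \<longrightarrow> (\<exists>s. (v t has_sum s) P \<and> norm (\<phi> - s) < \<epsilon>))"
    using int unfolding Birkhoff_integrable_def tagged_def v_def by blast
  define lim where "lim P t S \<longleftrightarrow>
      S \<in> ck \<and> ((\<lambda>E. hausdorff_dist S (zonotope E (v t))) \<longlongrightarrow> 0) (finite_subsets_at_top P)" for P t S
  have lim_ex: "\<exists>S. lim P t S" if "(v t has_sum s) P" for P t s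
    using zonotope_converges_if_has_sum[OF that] unfolding lim_def by metis
  \<comment> \<open>\<open>Z\<close> collects only limits that exist, so a bound on
    \<open>Z P0\<close> would not by itself give convergence over every refinement;
    \<open>good\<close> adds this. It also ensures that a common refinement contributes an element
    to the intersection of two tails.\<close>
  define good where "good P0 \<longleftrightarrow> countable_measurable_partition P0 \<and>
      (\<forall>P t. tagged P0 P t \<longrightarrow> (\<exists>S. lim P t S))" for P0
  define Z where "Z P0 = {S. \<exists>P t. tagged P0 P t \<and> lim P t S}" for P0
  define \<Q> where "\<Q> = Z ` {P0. good P0}"
  obtain \<Phi> where \<Phi>: "\<Phi> \<in> ck" "\<And>\<epsilon>. \<epsilon> > 0 \<Longrightarrow> \<exists>Q\<in>\<Q>. \<forall>S\<in>Q. hausdorff_dist \<Phi> S \<le> \<epsilon>"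
  proof (rule ck_Cauchy_base_limit[of \<Q>])
    fix Q assume "Q \<in> \<Q>"
    then show "Q \<subseteq> ck" by (auto simp: \<Q>_def Z_def lim_def)
  next
    fix Q Q' assume "Q \<in> \<Q>" "Q' \<in> \<Q>"
    then obtain P P' where P: "good P" "Q = Z P" and P': "good P'" "Q' = Z P'"
      by (auto simp: \<Q>_def)
    then have PP': "countable_measurable_partition P" "countable_measurable_partition P'"
      by (simp_all add: good_def)
    obtain R where R: "countable_measurable_partition R" "refines {0..1} R P" "refines {0..1} R P'"
      using common_refinement_measurable[OF PP'] .
    obtain t where t: "\<And>A. A \<in> R \<Longrightarrow> t A \<in> A"
      using countable_measurable_partition_tags[OF R(1)] by blast
    have tag: "tagged P R t" "tagged P' R t"
      using R t by (auto simp: tagged_def)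
    then obtain S where "lim R t S"
      using P(1) unfolding good_def by blast
    with tag P(2) P'(2) show "Q \<inter> Q' \<noteq> {}"
      unfolding Z_def by blast
  next
    fix \<epsilon> :: real assume "\<epsilon> > 0"
    \<comment> \<open>Every limit in \<open>Z P0\<close> is within \<open>2 * (\<epsilon>/4)\<close>
      of the reference limit \<open>T\<close>, hence any two are within \<epsilon> of each
      other.\<close>
    then have "\<epsilon>/4 > 0" by simp
    obtain P0 where P0: "countable_measurable_partition P0"
      and close: "\<And>P t. tagged P0 P t \<Longrightarrow> \<exists>s. (v t has_sum s) P \<and> norm (\<phi> - s) < \<epsilon>/4"
      using part[OF \<open>\<epsilon>/4 > 0\<close>] by blast
    have good: "good P0"
      unfolding good_def using P0 close lim_ex by blast
    have tag0: "tagged P0 P0 t" if "\<And>A. A \<in> P0 \<Longrightarrow> t A \<in> A" for t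
      using that P0 countable_measurable_partition_refines_refl[OF P0] by (simp add: tagged_def)
    obtain t0 where t0: "\<And>A. A \<in> P0 \<Longrightarrow> t0 A \<in> A"
      using countable_measurable_partition_tags[OF P0] by blast
    obtain T where T: "lim P0 t0 T"
      using good tag0[OF t0] unfolding good_def by blast
    have near: "hausdorff_dist S T \<le> 2 * (\<epsilon>/4)" if S: "S \<in> Z P0" for S
    proof -
      obtain P t where Pt: "tagged P0 P t" "lim P t S" using S by (auto simp: Z_def)
      show ?thesis
      proof (rule Birkhoff_zonotope_limits_close[OF P0, where P = P and r = t and t = t0 and g = g])
        show "countable_measurable_partition P" "refines {0..1} P P0" "\<And>C. C \<in> P \<Longrightarrow> t C \<in> C"
          using Pt(1) by (auto simp: tagged_def)
        show "\<exists>s. ((\<lambda>A. measure lebesgue A *\<^sub>R g (t A)) has_sum s) P0 \<and> norm (\<phi> - s) < \<epsilon>/4"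
          if "\<And>A. A \<in> P0 \<Longrightarrow> t A \<in> A" for t
          using close[OF tag0[OF that]] by (simp add: v_def)
        show "S \<in> ck" "((\<lambda>E. hausdorff_dist S (zonotope E (\<lambda>C. measure lebesgue C *\<^sub>R g (t C)))) \<longlongrightarrow> 0)
            (finite_subsets_at_top P)"
          using Pt(2) by (simp_all add: lim_def v_def)
        show "T \<in> ck" "((\<lambda>E. hausdorff_dist T (zonotope E (\<lambda>A. measure lebesgue A *\<^sub>R g (t0 A)))) \<longlongrightarrow> 0)
            (finite_subsets_at_top P0)"
          using T by (simp_all add: lim_def v_def)
      qed (fact t0)
    qed
    have ckZ: "S \<in> ck" if "S \<in> Z P0" for S using that by (auto simp: Z_def lim_def)
    have "T \<in> ck" using T by (simp add: lim_def)
    have "hausdorff_dist S S' \<le> 2 * (\<epsilon>/4) + 2 * (\<epsilon>/4)" if "S \<in> Z P0" "S' \<in> Z P0" for S S'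
      using near[OF that(1)] near[OF that(2)]
      by (intro hausdorff_dist_triangle2[OF ckZ \<open>T \<in> ck\<close> ckZ] that) (simp_all add: hausdorff_dist_commute)
    then have "\<forall>S\<in>Z P0. \<forall>S'\<in>Z P0. hausdorff_dist S S' \<le> \<epsilon>" by simp
    with good show "\<exists>Q\<in>\<Q>. \<forall>S\<in>Q. \<forall>T\<in>Q. hausdorff_dist S T \<le> \<epsilon>"
      unfolding \<Q>_def by blast
  qed blast
  show ?thesis
    unfolding Birkhoff_integrable_multi_def
  proof (intro bexI[of _ \<Phi>] allI impI)
    fix \<epsilon> :: real assume "\<epsilon> > 0"
    \<comment> \<open>Halving \<epsilon> turns the weak bound from the Cauchy criterion into the
      strict one required.\<close>
    then obtain P0 where P0: "good P0" "\<forall>S\<in>Z P0. hausdorff_dist \<Phi> S \<le> \<epsilon>/2"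
      using \<Phi>(2)[of "\<epsilon>/2"] by (auto simp: \<Q>_def)
    have "\<exists>S. hausdorff_has_sum (\<lambda>A. (\<lambda>x. measure lebesgue A *\<^sub>R x) ` G (t A)) S P \<and>
        hausdorff_dist \<Phi> S < \<epsilon>"
      if P: "countable_measurable_partition P" "refines {0..1} P P0" "\<forall>A\<in>P. t A \<in> A" for P t
    proof -
      have tag: "tagged P0 P t" using P by (simp add: tagged_def)
      then obtain S where S: "lim P t S" using P0(1) unfolding good_def by blast
      then have "S \<in> Z P0" using tag unfolding Z_def by blast
      then have "hausdorff_dist \<Phi> S < \<epsilon>" using P0(2) \<open>\<epsilon> > 0\<close> by fastforce
      moreover have "hausdorff_has_sum (\<lambda>A. (\<lambda>x. measure lebesgue A *\<^sub>R x) ` G (t A)) S P"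
        using hausdorff_has_sum_iff_zonotope[OF G P(1), of t S] P(3) S by (simp add: lim_def v_def)
      ultimately show ?thesis by blast
    qed
    moreover have "countable_measurable_partition P0" using P0(1) by (simp add: good_def)
    ultimately show "\<exists>P\<^sub>0. countable_measurable_partition P\<^sub>0 \<and>
        (\<forall>P t. countable_measurable_partition P \<and> refines {0..1} P P\<^sub>0 \<and> (\<forall>A\<in>P. t A \<in> A) \<longrightarrow>
           (\<exists>S. hausdorff_has_sum (\<lambda>A. (\<lambda>x. measure lebesgue A *\<^sub>R x) ` G (t A)) S P \<and>
                hausdorff_dist \<Phi> S < \<epsilon>))"
      by blast
  qed (fact \<Phi>(1))
qed

theorem theorem2p7:
  fixes g :: "real \<Rightarrow> 'a::banach" and G :: "real \<Rightarrow> 'a set"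
  assumes "\<forall>t\<in>{0..1}. G t = convex hull {0, g t}"
  shows "(McShane_integrable_multi G \<longleftrightarrow> McShane_integrable g) \<and>
         (Birkhoff_integrable_multi G \<longleftrightarrow> Birkhoff_integrable g)"
  using McShane_integrable_if_multi[OF assms] McShane_integrable_multi_if[OF assms]
    Birkhoff_integrable_if_multi[OF assms] Birkhoff_integrable_multi_if[OF assms]
  by blast

end
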